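(* Let $c>2$ be a real number with $c\notin\mathbb{N}$, and let $\beta(c)>0$ be a constant such that for all positive integers $N$ and $q$ and every primitive Dirichlet character $\chi$ modulo $q$, $$\sum_{N/2<n\le N}\chi(\lfloor n^c\rfloor)\ll q^{1/2}N^{1-\beta(c)},$$ with an implied constant depending only on $c$. Then, as $N\to\infty$, uniformly for real $S$ with $1\le S\le N^c$, $$\mathfrak{Q}_c(S,N)\le \left(SN^{1-\beta(c)}+S^{3/4}N^{1-\beta(c)/2}\right)N^{o(1)};$$ that is, for every $\varepsilon>0$ there is $C=C(c,\varepsilon)$ with $\mathfrak{Q}_c(S,N)\le CN^{\varepsilon}\left(SN^{1-\beta(c)}+S^{3/4}N^{1-\beta(c)/2}\right)$ for all such $N,S$.
   Context: For a real $c>1$ and positive integers $s,N$, $Q_c(s;N)$ denotes the number of integers $n$ with $1\le n\le N$ such that $\lfloor n^c\rfloor=sm^2$ for some integer $m$ (where $\lfloor z\rfloor$ is the integer part). For real $S\ge1$, $\mathfrak{Q}_c(S,N)=\sum_{s\le S,\ s \text{ square-free}}Q_c(s;N)$, the sum over positive square-free integers $s\le S$. *)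

theory Defs
  imports "HOL-Analysis.Analysis" "HOL-Computational_Algebra.Squarefree"
begin

(* Characters modulo q are represented as q-periodic functions on all integers,
   extended by 0 to the integers not coprime to q. *)
definition dirichlet_character :: "nat \<Rightarrow> (int \<Rightarrow> complex) \<Rightarrow> bool" where
  "dirichlet_character q chi \<longleftrightarrow>
     q > 0 \<and>
     chi 1 = 1 \<and>
     (\<forall>a b. chi (a * b) = chi a * chi b) \<and>
     (\<forall>a. chi (a + int q) = chi a) \<and>
     (\<forall>a. chi a \<noteq> 0 \<longleftrightarrow> coprime a (int q))"

(* Not induced by a character to a proper divisor of the modulus. With this definition
   the trivial character modulo 1 is primitive; some authors exclude it. *)
definition primitive_character :: "nat \<Rightarrow> (int \<Rightarrow> complex) \<Rightarrow> bool" where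
  "primitive_character q chi \<longleftrightarrow>
     dirichlet_character q chi \<and>
     \<not> (\<exists>d psi. d dvd q \<and> d < q \<and> dirichlet_character d psi \<and>
            (\<forall>a. coprime a (int q) \<longrightarrow> chi a = psi a))"

definition Q_count :: "real \<Rightarrow> nat \<Rightarrow> nat \<Rightarrow> nat" where
  "Q_count c s N = card {n \<in> {1..N}. \<exists>m::int. \<lfloor>real n powr c\<rfloor> = int s * m\<^sup>2}"

definition frak_Q :: "real \<Rightarrow> real \<Rightarrow> nat \<Rightarrow> nat" where
  "frak_Q c S N = (\<Sum>s \<in> {s::nat. s > 0 \<and> real s \<le> S \<and> squarefree s}. Q_count c s N)"

end

theory Submission
  imports Defs "HOL-Number_Theory.Number_Theory" "HOL-Real_Asymp.Real_Asymp"
begin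

text \<open>
  If \<open>a = s * m\<^sup>2\<close>, then \<open>s * a\<close> is a square, so its Legendre symbol is 1 at almost every prime of
  a set of \<open>k\<close> primes up to \<open>Z\<close>. Summing the square of the sum of these symbols over all squarefree
  \<open>s \<le> S\<close> and a dyadic block of \<open>n\<close> bounds the count by \<open>S * N / k\<close> plus an average over pairs \<open>p \<noteq> q\<close>
  of a character sum modulo \<open>p * q\<close> in \<open>\<lfloor>n powr c\<rfloor>\<close>, controlled by the hypothesis, times a character
  sum modulo \<open>p * q\<close> in \<open>s\<close>. Reciprocity turns the latter into characters modulo the odd part of \<open>s\<close>
  at \<open>p * q\<close>, and Cauchy-Schwarz reduces them to their mean square over all \<open>m \<le> Z\<^sup>2\<close>.
  With \<open>Z\<close> about \<open>S powr (1/4) * N powr (\<beta>/2)\<close>, the case \<open>S > Z\<close> is trivial since each \<open>n\<close> is counted for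
  only one \<open>s\<close>. In the case \<open>S \<le> Z\<close> the moduli \<open>s * t \<le> S\<^sup>2\<close> do not exceed the length \<open>Z\<^sup>2\<close>, so square
  root cancellation in complete correlations suffices, and Heath-Brown's quadratic large sieve
  is not needed.
\<close>

section \<open>Sums of periodic functions\<close>

text \<open>Up to small powers there are Z sieve primes. The diagonal p = q costs S N / Z and the
  pairs p \<noteq> q cost S^(1/2) N^(1-\<beta>) Z; the chosen Z makes these equal, and both are then
  S^(3/4) N^(1-\<beta>/2). For this Z the condition S \<le> Z says S^(3/4) \<le> N^(\<beta>/2), so
  the complementary range is where the target is at least N. Reciprocity is forced because, for S
  \<le> Z, a sum over s has at most S terms against a modulus p q as large as Z^2; after the flip
  the long variable is the argument and the short one the modulus. The choice of Z also uses \<beta>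
  \<le> 1, to keep Z at most about N and the final exponent positive; this is extracted from the
  hypothesis itself.\<close>

definition periodic :: "nat \<Rightarrow> (int \<Rightarrow> 'a) \<Rightarrow> bool" where
  "periodic q f \<longleftrightarrow> (\<forall>a. f (a + int q) = f a)"

lemma periodic_plus_mult:
  assumes "periodic q f"
  shows "f (a + int q * k) = f a"
proof (induction k rule: int_induct[where k = 0])
  case (step1 i)
  have "f (a + int q * (i + 1)) = f ((a + int q * i) + int q)"
    by (simp add: algebra_simps)
  then show ?case using step1 assms by (simp add: periodic_def)
next
  case (step2 i)
  have "f (a + int q * i) = f ((a + int q * (i - 1)) + int q)"
    by (simp add: algebra_simps)
  then show ?case using step2 assms by (simp add: periodic_def)
qed simp

lemma periodic_cong:
  assumes "periodic q f" "[a = b] (mod int q)"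
  shows "f a = f b"
proof -
  from assms(2) obtain k where "b = a + int q * k"
    by (metis cong_iff_lin)
  then show ?thesis using periodic_plus_mult[OF assms(1)] by simp
qed

lemma periodic_dvd:
  assumes "periodic q f" "q dvd n"
  shows "periodic n f"
proof -
  from assms(2) obtain k where "n = q * k" ..
  then show ?thesis
    using periodic_plus_mult[OF assms(1), of _ "int k"] by (simp add: periodic_def)
qed

lemma periodic_shift:
  assumes "periodic q f"
  shows "periodic q (\<lambda>a. f (a + h))" "periodic q (\<lambda>a. f (h + a))"
proof -
  have "a + int q + h = (a + h) + int q" "h + (a + int q) = (h + a) + int q" for a
    by simp_all
  then show "periodic q (\<lambda>a. f (a + h))" "periodic q (\<lambda>a. f (h + a))"
    using assms unfolding periodic_def by metis+
qed

lemma periodic_mult: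
  "periodic q f \<Longrightarrow> periodic q g \<Longrightarrow> periodic q (\<lambda>a. f a * g a)"
  by (simp add: periodic_def)

text \<open>\<open>b\<close> is a unit modulo \<open>q\<close>, so the affine map permutes the
  residues; the case \<open>b = 1\<close> is invariance under shifts.\<close>

lemma sum_periodic_affine:
  fixes f :: "int \<Rightarrow> 'a::comm_monoid_add"
  assumes "periodic q f" "q > 0" "coprime b (int q)"
  shows "(\<Sum>a<q. f (b * int a + h)) = (\<Sum>a<q. f (int a))"
proof -
  define g where "g a = nat ((b * int a + h) mod int q)" for a :: nat
  have g: "int (g a) = (b * int a + h) mod int q" for a
    using assms(2) by (simp add: g_def)
  have "inj_on g {..<q}"
  proof (rule inj_onI)
    fix x y assume xy: "x \<in> {..<q}" "y \<in> {..<q}" "g x = g y"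
    from xy(3) have "[b * int x + h = b * int y + h] (mod int q)"
      by (metis g cong_def)
    then have "[b * int x = b * int y] (mod int q)"
      by (simp add: cong_add_rcancel)
    then have "[int x = int y] (mod int q)"
      using assms(3) by (simp add: cong_mult_lcancel)
    then have "[x = y] (mod q)" by (simp add: cong_int_iff)
    then show "x = y" using xy by (auto intro: cong_less_modulus_unique_nat)
  qed
  moreover have "g ` {..<q} \<subseteq> {..<q}"
    using assms(2) by (auto simp: g_def nat_less_iff)
  ultimately have "bij_betw g {..<q} {..<q}"
    by (simp add: bij_betw_def endo_inj_surj)
  then have "(\<Sum>a<q. f (int a)) = (\<Sum>a<q. f (int (g a)))"
    by (rule sum.reindex_bij_betw[symmetric])
  also have "\<dots> = (\<Sum>a<q. f (b * int a + h))"
    unfolding g by (intro sum.cong refl periodic_cong[OF assms(1)]) simp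
  finally show ?thesis by simp
qed

lemma sum_periodic_shift:
  fixes f :: "int \<Rightarrow> 'a::comm_monoid_add"
  assumes "periodic q f" "q > 0"
  shows "(\<Sum>a<q. f (int a + h)) = (\<Sum>a<q. f (int a))"
  using sum_periodic_affine[OF assms, of 1 h] by simp

text \<open>Used in two ways: when the full period sums to zero only the incomplete period survives,
  and for nonnegative summands at most \<open>n div q + 1\<close> full periods are counted.\<close>

lemma sum_periodic_split:
  fixes f :: "int \<Rightarrow> 'a::comm_semiring_1"
  assumes "periodic q f" "q > 0"
  shows "(\<Sum>a<n. f (int a)) = of_nat (n div q) * (\<Sum>a<q. f (int a)) + (\<Sum>a<n mod q. f (int a))"
proof -
  have shift: "(\<Sum>a<k * q + r. f (int a)) = of_nat k * (\<Sum>a<q. f (int a)) + (\<Sum>a<r. f (int a))" for k r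
  proof (induction k arbitrary: r)
    case (Suc k)
    have "(\<Sum>a<Suc k * q + r. f (int a)) = (\<Sum>a<k * q + (q + r). f (int a))"
      by (simp add: algebra_simps)
    also have "\<dots> = of_nat k * (\<Sum>a<q. f (int a)) + (\<Sum>a<q + r. f (int a))"
      by (rule Suc)
    also have "(\<Sum>a<q + r. f (int a)) = (\<Sum>a<q. f (int a)) + (\<Sum>a=q..<q+r. f (int a))"
      using sum.atLeastLessThan_concat[of 0 q "q + r" "\<lambda>a. f (int a)"]
      by (simp add: atLeast0LessThan)
    also have "(\<Sum>a=q..<q+r. f (int a)) = (\<Sum>a<r. f (int a + int q))"
      using sum.shift_bounds_nat_ivl[of "\<lambda>a. f (int a)" 0 q r]
      by (simp add: atLeast0LessThan add.commute)
    also have "\<dots> = (\<Sum>a<r. f (int a))"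
      using assms(1) by (simp add: periodic_def)
    finally show ?case by (simp add: algebra_simps)
  qed simp
  show ?thesis using shift[of "n div q" "n mod q"] by simp
qed

text \<open>By the Chinese remainder theorem the pair of residues runs through
  \<open>{..<p} \<times> {..<q}\<close> exactly once.\<close>

lemma sum_periodic_coprime:
  fixes f g :: "int \<Rightarrow> 'a::comm_semiring_1"
  assumes "periodic p f" "periodic q g" "coprime p q" "p > 0" "q > 0"
  shows "(\<Sum>a<p * q. f (int a) * g (int a)) = (\<Sum>a<p. f (int a)) * (\<Sum>a<q. g (int a))"
proof -
  define h where "h a = (a mod p, a mod q)" for a :: nat
  have "inj_on h {..<p * q}"
  proof (rule inj_onI)
    fix x y assume xy: "x \<in> {..<p * q}" "y \<in> {..<p * q}" "h x = h y"
    then have "[x = y] (mod p)" "[x = y] (mod q)" by (auto simp: h_def cong_def)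
    then have "[x = y] (mod p * q)" using assms(3) by (rule coprime_cong_mult_nat)
    then show "x = y" using xy by (auto intro: cong_less_modulus_unique_nat)
  qed
  moreover have "h ` {..<p * q} \<subseteq> {..<p} \<times> {..<q}"
    using assms by (auto simp: h_def)
  ultimately have "bij_betw h {..<p * q} ({..<p} \<times> {..<q})"
    by (metis bij_betw_def card_cartesian_product card_image card_lessThan card_subset_eq
        finite_SigmaI finite_lessThan)
  then have "(\<Sum>z\<in>{..<p} \<times> {..<q}. f (int (fst z)) * g (int (snd z)))
     = (\<Sum>a<p * q. f (int (fst (h a))) * g (int (snd (h a))))"
    by (rule sum.reindex_bij_betw[symmetric])
  also have "\<dots> = (\<Sum>a<p * q. f (int a) * g (int a))"
  proof (intro sum.cong refl arg_cong2[where f = times])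
    fix a
    show "f (int (fst (h a))) = f (int a)"
      by (rule periodic_cong[OF assms(1)]) (simp add: h_def cong_def zmod_int)
    show "g (int (snd (h a))) = g (int a)"
      by (rule periodic_cong[OF assms(2)]) (simp add: h_def cong_def zmod_int)
  qed
  finally show ?thesis
    by (simp add: sum_product sum.cartesian_product case_prod_unfold)
qed

lemma periodic_prod:
  assumes "finite R" "\<And>r. r \<in> R \<Longrightarrow> periodic r (f r)"
  shows "periodic (\<Prod>R) (\<lambda>a. \<Prod>r\<in>R. f r a)"
proof -
  have "periodic (\<Prod>R) (f r)" if "r \<in> R" for r
    using assms that dvd_prodI[of R r "\<lambda>x. x"] by (auto intro: periodic_dvd)
  then show ?thesis by (simp add: periodic_def)
qed

lemma prod_set_primes_pos: "(\<And>r. r \<in> R \<Longrightarrow> prime r) \<Longrightarrow> \<Prod>R > (0::nat)"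
  by (auto intro!: prod_pos dest: prime_gt_0_nat)

lemma coprime_prod_set_primes:
  assumes "prime p" "p \<notin> R" "\<And>r. r \<in> R \<Longrightarrow> prime r"
  shows "coprime p (\<Prod>R :: nat)"
  using assms by (intro prod_coprime_right) (auto intro: primes_coprime)

text \<open>Reduces a sum over the residues of a squarefree modulus to one sum per prime. It serves
  for the residue \<open>a\<close> and, in correlations, also for the shift
  \<open>h\<close>.\<close>

lemma sum_prod_periodic:
  fixes f :: "nat \<Rightarrow> int \<Rightarrow> 'a::comm_semiring_1"
  assumes "finite R" "\<And>r. r \<in> R \<Longrightarrow> prime r" "\<And>r. r \<in> R \<Longrightarrow> periodic r (f r)"
  shows "(\<Sum>a<\<Prod>R. \<Prod>r\<in>R. f r (int a)) = (\<Prod>r\<in>R. \<Sum>a<r. f r (int a))"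
  using assms
proof (induction R rule: finite_induct)
  case (insert p R)
  have "(\<Sum>a<p * \<Prod>R. f p (int a) * (\<Prod>r\<in>R. f r (int a)))
      = (\<Sum>a<p. f p (int a)) * (\<Sum>a<\<Prod>R. \<Prod>r\<in>R. f r (int a))"
  proof (rule sum_periodic_coprime)
    show "periodic (\<Prod>R) (\<lambda>a. \<Prod>r\<in>R. f r a)"
      using insert by (intro periodic_prod) auto
    show "coprime p (\<Prod>R)"
      using insert by (intro coprime_prod_set_primes) auto
    show "p > 0" "\<Prod>R > 0"
      using insert by (auto intro: prod_set_primes_pos dest: prime_gt_0_nat)
  qed (use insert in auto)
  then show ?case using insert by simp
qed simp

section \<open>The Legendre symbol\<close>

lemma Legendre_cases: "Legendre a p = 0 \<or> Legendre a p = 1 \<or> Legendre a p = -1"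
  by (auto simp: Legendre_def)

lemma abs_Legendre_le: "\<bar>Legendre a p\<bar> \<le> 1"
  using Legendre_cases[of a p] by auto

lemma Legendre_eq_0_iff: "Legendre a p = 0 \<longleftrightarrow> p dvd a"
  by (simp add: Legendre_def cong_0_iff)

lemma Legendre_cong: "[a = b] (mod p) \<Longrightarrow> Legendre a p = Legendre b p"
  by (simp add: Legendre_def QuadRes_def cong_def)

lemma periodic_Legendre: "periodic p (\<lambda>a. Legendre a (int p))"
  unfolding periodic_def by (auto intro!: Legendre_cong simp: cong_def)

text \<open>The values -1, 0, 1 stay distinct modulo \<open>p > 2\<close>, so Euler's criterion,
  which is only a congruence, yields equalities of Legendre symbols.\<close>

lemma Legendre_sgn_cong:
  assumes "[x = y] (mod p)" "\<bar>x\<bar> \<le> 1" "\<bar>y\<bar> \<le> 1" "p > (2::int)"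
  shows "x = (y::int)"
proof -
  have "p dvd x - y" using assms(1) by (simp add: cong_iff_dvd_diff)
  moreover have "\<bar>x - y\<bar> < p" using assms by linarith
  ultimately show ?thesis using zdvd_not_zless[of "\<bar>x - y\<bar>" p] by auto
qed

lemma Legendre_mult:
  assumes "prime p" "2 < p"
  shows "Legendre (a * b) (int p) = Legendre a (int p) * Legendre b (int p)"
proof (rule Legendre_sgn_cong[where p = "int p"])
  have "[Legendre a (int p) * Legendre b (int p) = a ^ ((p-1) div 2) * b ^ ((p-1) div 2)] (mod int p)"
    by (intro cong_mult euler_criterion assms)
  then show "[Legendre (a * b) (int p) = Legendre a (int p) * Legendre b (int p)] (mod int p)"
    using euler_criterion[OF assms, of "a * b"]
    by (metis cong_sym cong_trans power_mult_distrib)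
  show "\<bar>Legendre a (int p) * Legendre b (int p)\<bar> \<le> 1"
    using Legendre_cases[of a "int p"] Legendre_cases[of b "int p"] by auto
qed (use assms abs_Legendre_le in auto)

lemma Legendre_1 [simp]: "prime p \<Longrightarrow> Legendre 1 (int p) = 1"
  unfolding Legendre_def QuadRes_def
  by (auto simp: cong_0_iff intro!: exI[of _ 1] dest: prime_gt_1_nat)

text \<open>Squaring sends 1 and \<open>p - 1\<close> to the same residue. A self-map of a finite
  set that is not injective is not surjective, so some residue is not a square.\<close>

lemma ex_nonresidue:
  assumes "prime p" "2 < p"
  shows "\<exists>a. Legendre a (int p) = -1"
proof -
  define g where "g x = x\<^sup>2 mod p" for x :: nat
  have "\<not> inj_on g {..<p}"
  proof
    assume "inj_on g {..<p}"
    moreover have "[(p - 1)\<^sup>2 = 1\<^sup>2] (mod p)"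
    proof -
      have "[int (p - 1) = -1] (mod int p)" using assms by (simp add: cong_iff_dvd_diff of_nat_diff)
      then have "[int (p - 1) ^ 2 = (-1) ^ 2] (mod int p)" by (rule cong_pow)
      then have "[int ((p - 1) ^ 2) = int 1] (mod int p)" by simp
      then show ?thesis by (subst (asm) cong_int_iff) simp
    qed
    then have "g (p - 1) = g 1" by (simp add: g_def cong_def)
    ultimately have "p - 1 = 1" using assms by (auto dest: inj_onD)
    then show False using assms by simp
  qed
  then have "g ` {..<p} \<noteq> {..<p}"
    using eq_card_imp_inj_on[of "{..<p}" g] by auto
  moreover have "g ` {..<p} \<subseteq> {..<p}" using assms by (auto simp: g_def)
  ultimately obtain a where a: "a < p" "a \<notin> g ` {..<p}" by blast
  have "\<not> QuadRes (int p) (int a)"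
  proof
    assume "QuadRes (int p) (int a)"
    then obtain y where y: "[y\<^sup>2 = int a] (mod int p)" by (auto simp: QuadRes_def)
    define z where "z = nat (y mod int p)"
    have z: "int z = y mod int p" "z < p" using assms by (auto simp: z_def nat_less_iff)
    have "[int z ^ 2 = y ^ 2] (mod int p)" unfolding z by (intro cong_pow) simp
    then have "[int (z ^ 2) = int a] (mod int p)" using y by (auto intro: cong_trans)
    then have "[z ^ 2 = a] (mod p)" by (simp only: cong_int_iff)
    then have "g z = a" using a by (simp add: g_def cong_def)
    then show False using a z by auto
  qed
  moreover have "a \<noteq> 0"
  proof
    assume "a = 0"
    then have "a = g 0" by (simp add: g_def)
    moreover have "0 \<in> {..<p}" using assms by simp
    ultimately show False using a(2) by (metis imageI)
  qed
  then have "\<not> [int a = 0] (mod int p)" using a(1) by (auto simp: cong_0_iff dest: dvd_imp_le)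
  ultimately show ?thesis by (auto simp: Legendre_def)
qed

text \<open>Multiplying the variable by a nonresidue permutes the residues and changes the sign of
  the sum.\<close>

lemma sum_Legendre:
  assumes "prime p" "2 < p"
  shows "(\<Sum>a<p. Legendre (int a) (int p)) = 0"
proof -
  obtain b where b: "Legendre b (int p) = -1" using ex_nonresidue[OF assms] ..
  then have "coprime b (int p)"
    using assms by (metis Legendre_eq_0_iff coprime_commute prime_imp_coprime prime_nat_int_transfer zero_neq_neg_one)
  then have "(\<Sum>a<p. Legendre (int a) (int p)) = (\<Sum>a<p. Legendre (b * int a + 0) (int p))"
    using assms by (subst sum_periodic_affine[OF periodic_Legendre]) auto
  also have "\<dots> = - (\<Sum>a<p. Legendre (int a) (int p))"
    using assms by (simp add: Legendre_mult b sum_negf)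
  finally show ?thesis by simp
qed

text \<open>For \<open>h\<close> nonzero modulo \<open>p\<close>, substituting \<open>h * a\<close>
  for \<open>a\<close> shows that the correlation does not depend on \<open>h\<close>. Summed over
  all \<open>h\<close> the correlations vanish, so those with nonzero \<open>h\<close> have total
  absolute value \<open>C 0\<close>, and \<open>C 0 \<le> p\<close>.\<close>

lemma sum_abs_Legendre_correlation:
  assumes "prime p" "2 < p"
  shows "(\<Sum>h<p. \<bar>\<Sum>a<p. Legendre (int a) (int p) * Legendre (int a + int h) (int p)\<bar>) \<le> 2 * int p"
proof -
  define C where "C h = (\<Sum>a<p. Legendre (int a) (int p) * Legendre (int a + int h) (int p))" for h :: nat
  have C_const: "C h = C 1" if "0 < h" "h < p" for h
  proof -
    have cop: "coprime (int h) (int p)"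
      by (metis assms(1) coprime_commute coprime_int_iff nat_dvd_not_less prime_imp_coprime that)
    then have h2: "Legendre (int h) (int p) * Legendre (int h) (int p) = 1"
      using Legendre_cases[of "int h" "int p"] that Legendre_eq_0_iff[of "int h" "int p"]
      by (auto dest: nat_dvd_not_less)
    have "periodic p (\<lambda>a. Legendre a (int p) * Legendre (a + int h) (int p))"
      by (intro periodic_mult periodic_Legendre periodic_shift)
    from sum_periodic_affine[OF this _ cop, of 0]
    have "C h = (\<Sum>a<p. Legendre (int h * int a) (int p) * Legendre (int h * (int a + 1)) (int p))"
      using assms by (simp add: C_def algebra_simps)
    also have "\<dots> = (\<Sum>a<p. (Legendre (int h) (int p) * Legendre (int h) (int p)) *
        (Legendre (int a) (int p) * Legendre (int a + 1) (int p)))"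
      using assms by (intro sum.cong refl) (simp only: Legendre_mult ac_simps)
    also have "\<dots> = C 1" by (simp add: h2 C_def)
    finally show ?thesis .
  qed
  have split: "{..<p} = insert 0 {1..<p}" using assms by auto
  have tot: "(\<Sum>h<p. C h) = 0"
  proof -
    have "(\<Sum>h<p. C h) = (\<Sum>a<p. Legendre (int a) (int p) * (\<Sum>h<p. Legendre (int h + int a) (int p)))"
      unfolding C_def by (subst sum.swap) (simp add: sum_distrib_left add.commute)
    also have "\<dots> = 0"
      using assms by (simp add: sum_periodic_shift[OF periodic_Legendre] sum_Legendre)
    finally show ?thesis .
  qed
  have C0: "C 0 = \<bar>C 0\<bar>" "C 0 \<le> int p"
  proof -
    show "C 0 = \<bar>C 0\<bar>" by (simp add: C_def sum_nonneg)
    have "C 0 \<le> (\<Sum>a<p. 1)" unfolding C_def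
    proof (rule sum_mono)
      fix a
      show "Legendre (int a) (int p) * Legendre (int a + int 0) (int p) \<le> 1"
        using Legendre_cases[of "int a" "int p"] by auto
    qed
    then show "C 0 \<le> int p" by simp
  qed
  have "(\<Sum>h=1..<p. C h) = (\<Sum>h=1..<p. C 1)" by (intro sum.cong refl C_const) auto
  moreover have "(\<Sum>h=1..<p. \<bar>C h\<bar>) = (\<Sum>h=1..<p. \<bar>C 1\<bar>)"
    by (intro sum.cong refl arg_cong[where f = abs] C_const) auto
  ultimately have "(\<Sum>h=1..<p. \<bar>C h\<bar>) = \<bar>\<Sum>h=1..<p. C h\<bar>" by (simp add: abs_mult)
  also have "(\<Sum>h=1..<p. C h) = - C 0" using tot unfolding split by simp
  finally have "(\<Sum>h<p. \<bar>C h\<bar>) = 2 * C 0" unfolding split using C0 by simp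
  then show ?thesis using C0 by (simp add: C_def)
qed

section \<open>Products of Legendre symbols\<close>

text \<open>The Jacobi symbol modulo the squarefree number \<open>\<Prod>R\<close>. Indexing by the
  set of primes lets \<open>R = T\<close> decide which pairs are diagonal; the empty set gives the
  constant 1.\<close>

definition quad_char :: "nat set \<Rightarrow> int \<Rightarrow> int" where
  "quad_char R a = (\<Prod>r\<in>R. Legendre a (int r))"

definition odd_primes :: "nat set \<Rightarrow> bool" where
  "odd_primes R \<longleftrightarrow> finite R \<and> (\<forall>r\<in>R. prime r \<and> 2 < r)"

lemma abs_quad_char_le: "\<bar>quad_char R a\<bar> \<le> 1"
  unfolding quad_char_def abs_prod by (intro prod_le_1) (simp add: abs_Legendre_le)

lemma quad_char_mult:
  assumes "odd_primes R"
  shows "quad_char R (a * b) = quad_char R a * quad_char R b"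
  using assms unfolding quad_char_def odd_primes_def
  by (auto simp: Legendre_mult prod.distrib[symmetric] intro!: prod.cong)

lemma periodic_quad_char:
  assumes "odd_primes R"
  shows "periodic (\<Prod>R) (quad_char R)"
  using assms periodic_prod[of R "\<lambda>r a. Legendre a (int r)"]
  unfolding quad_char_def[abs_def] odd_primes_def by (simp add: periodic_Legendre)

lemma odd_primes_pos: "odd_primes R \<Longrightarrow> \<Prod>R > 0"
  by (rule prod_set_primes_pos) (simp add: odd_primes_def)

lemma odd_primes_Un: "odd_primes R \<Longrightarrow> odd_primes T \<Longrightarrow> odd_primes (R \<union> T)"
  by (auto simp: odd_primes_def)

text \<open>The local factor at \<open>r\<close> of the product of the characters of
  \<open>R\<close> and \<open>T\<close>. At a common prime it is the square of the Legendre symbol,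
  the principal character.\<close>

definition pair_factor :: "nat set \<Rightarrow> nat set \<Rightarrow> nat \<Rightarrow> int \<Rightarrow> int" where
  "pair_factor R T r a =
     (if r \<in> R then Legendre a (int r) else 1) * (if r \<in> T then Legendre a (int r) else 1)"

lemma prod_indicator_Un:
  assumes "finite R" "finite T"
  shows "(\<Prod>r\<in>R \<union> T. (if r \<in> R then f r else 1) * (if r \<in> T then f r else 1)) = prod f R * prod (f :: _ \<Rightarrow> int) T"
proof -
  have "(\<Prod>r\<in>R \<union> T. if r \<in> R then f r else 1) = prod f R"
    by (rule prod.mono_neutral_cong_right) (use assms in auto)
  moreover have "(\<Prod>r\<in>R \<union> T. if r \<in> T then f r else 1) = prod f T"
    by (rule prod.mono_neutral_cong_right) (use assms in auto)
  ultimately show ?thesis by (simp only: prod.distrib)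
qed

lemma quad_char_pair_eq:
  assumes "odd_primes R" "odd_primes T"
  shows "quad_char R a * quad_char T a = (\<Prod>r\<in>R \<union> T. pair_factor R T r a)"
  using assms unfolding pair_factor_def quad_char_def
  by (subst prod_indicator_Un) (simp_all add: odd_primes_def)

lemma periodic_pair_factor: "periodic r (pair_factor R T r)"
  using periodic_Legendre[of r] by (simp add: periodic_def pair_factor_def)

lemma abs_pair_factor_le: "\<bar>pair_factor R T r a\<bar> \<le> 1"
  using abs_Legendre_le[of a "int r"] by (auto simp: pair_factor_def abs_mult mult_le_one)

text \<open>At a common prime there is no cancellation and the trivial bound \<open>r * r\<close> is
  used; elsewhere the Legendre correlation gives \<open>2 * r\<close>. Writing the bound as an
  \<open>R\<close>-part times a \<open>T\<close>-part lets the global bound split into one factor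
  per character.\<close>

lemma sum_abs_pair_factor_correlation:
  assumes "r \<in> R \<union> T" "prime r" "2 < r"
  shows "(\<Sum>h<r. \<bar>\<Sum>a<r. pair_factor R T r (int a) * pair_factor R T r (int a + int h)\<bar>)
    \<le> (if r \<in> R then 2 * int r else 1) * (if r \<in> T then 2 * int r else 1)"
proof (cases "r \<in> R \<and> r \<in> T")
  case True
  have "(\<Sum>h<r. \<bar>\<Sum>a<r. pair_factor R T r (int a) * pair_factor R T r (int a + int h)\<bar>)
      \<le> (\<Sum>h<r. \<Sum>a<r. \<bar>pair_factor R T r (int a) * pair_factor R T r (int a + int h)\<bar>)"
    by (intro sum_mono sum_abs)
  also have "\<dots> \<le> (\<Sum>h<r. \<Sum>a<r. 1)"
    unfolding abs_mult by (intro sum_mono mult_le_one abs_pair_factor_le) auto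
  also have "\<dots> = int r * int r" by simp
  also have "\<dots> \<le> (2 * int r) * (2 * int r)" by (intro mult_mono) auto
  finally show ?thesis using True by simp
next
  case False
  then have "pair_factor R T r = (\<lambda>a. Legendre a (int r))"
    using assms(1) by (auto simp: pair_factor_def fun_eq_iff)
  then show ?thesis
    using False assms(1) sum_abs_Legendre_correlation[OF assms(2,3)] by auto
qed

definition pair_corr :: "nat set \<Rightarrow> nat set \<Rightarrow> int \<Rightarrow> int" where
  "pair_corr R T h = (\<Sum>a<\<Prod>(R \<union> T). (quad_char R (int a) * quad_char T (int a)) *
      (quad_char R (int a + h) * quad_char T (int a + h)))"

lemma periodic_pair:
  assumes "odd_primes R" "odd_primes T"
  shows "periodic (\<Prod>(R \<union> T)) (\<lambda>a. quad_char R a * quad_char T a)"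
  using assms odd_primes_Un[OF assms]
  by (simp add: quad_char_pair_eq[OF assms] periodic_prod periodic_pair_factor odd_primes_def)

lemma pair_corr_eq_prod:
  assumes "odd_primes R" "odd_primes T"
  shows "pair_corr R T h =
    (\<Prod>r\<in>R \<union> T. \<Sum>a<r. pair_factor R T r (int a) * pair_factor R T r (int a + h))"
proof -
  have "pair_corr R T h = (\<Sum>a<\<Prod>(R \<union> T). \<Prod>r\<in>R \<union> T. pair_factor R T r (int a) * pair_factor R T r (int a + h))"
    by (simp add: pair_corr_def quad_char_pair_eq[OF assms] prod.distrib)
  also have "\<dots> = (\<Prod>r\<in>R \<union> T. \<Sum>a<r. pair_factor R T r (int a) * pair_factor R T r (int a + h))"
  proof (rule sum_prod_periodic[where f = "\<lambda>r a. pair_factor R T r a * pair_factor R T r (a + h)"])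
    fix r
    show "periodic r (\<lambda>a. pair_factor R T r a * pair_factor R T r (a + h))"
      by (intro periodic_mult periodic_shift periodic_pair_factor)
  qed (use odd_primes_Un[OF assms] in \<open>auto simp: odd_primes_def\<close>)
  finally show ?thesis .
qed

text \<open>The sum over \<open>a\<close> and, since absolute values are multiplicative, also the
  sum over \<open>h\<close> factor over the primes. For disjoint \<open>R\<close> and
  \<open>T\<close> the result is, up to powers of 2, the period instead of its square.\<close>

lemma sum_abs_pair_corr:
  assumes "odd_primes R" "odd_primes T"
  shows "(\<Sum>h<\<Prod>(R \<union> T). \<bar>pair_corr R T (int h)\<bar>) \<le> (\<Prod>r\<in>R. 2 * int r) * (\<Prod>r\<in>T. 2 * int r)"
proof -
  define c where "c r h = \<bar>\<Sum>a<r. pair_factor R T r (int a) * pair_factor R T r (int a + h)\<bar>" for r h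
  have fin: "finite R" "finite T" using assms by (auto simp: odd_primes_def)
  have "(\<Sum>h<\<Prod>(R \<union> T). \<bar>pair_corr R T (int h)\<bar>) = (\<Sum>h<\<Prod>(R \<union> T). \<Prod>r\<in>R \<union> T. c r (int h))"
    by (simp add: pair_corr_eq_prod[OF assms] c_def abs_prod)
  also have "\<dots> = (\<Prod>r\<in>R \<union> T. \<Sum>h<r. c r (int h))"
  proof (rule sum_prod_periodic)
    fix r
    have "pair_factor R T r (a + (h + int r)) = pair_factor R T r (a + h)" for a h
      using periodic_shift(2)[OF periodic_pair_factor[of r R T], of a] by (simp add: periodic_def)
    then show "periodic r (c r)" by (simp add: periodic_def c_def)
  qed (use odd_primes_Un[OF assms] in \<open>auto simp: odd_primes_def\<close>)
  also have "\<dots> \<le> (\<Prod>r\<in>R \<union> T. (if r \<in> R then 2 * int r else 1) * (if r \<in> T then 2 * int r else 1))"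
  proof (intro prod_mono conjI)
    fix r assume "r \<in> R \<union> T"
    then show "(\<Sum>h<r. c r (int h)) \<le> (if r \<in> R then 2 * int r else 1) * (if r \<in> T then 2 * int r else 1)"
      unfolding c_def using assms by (intro sum_abs_pair_factor_correlation) (auto simp: odd_primes_def)
  qed (simp add: c_def sum_nonneg)
  also have "\<dots> = (\<Prod>r\<in>R. 2 * int r) * (\<Prod>r\<in>T. 2 * int r)"
    by (rule prod_indicator_Un[OF fin])
  finally show ?thesis .
qed

text \<open>Expanding the square turns the average over \<open>a\<close> into correlations at the
  differences \<open>l - k\<close>. As \<open>L\<close> is at most the period, for each
  \<open>k\<close> these differences are distinct residues and contribute at most the full sum over
  shifts.\<close>

lemma second_moment_shifts:
  assumes "odd_primes R" "odd_primes T" "L \<le> \<Prod>(R \<union> T)"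
  shows "(\<Sum>a<\<Prod>(R \<union> T). (\<Sum>l<L. quad_char R (int a + int l) * quad_char T (int a + int l))\<^sup>2)
    \<le> int (\<Prod>(R \<union> T)) * ((\<Prod>r\<in>R. 2 * int r) * (\<Prod>r\<in>T. 2 * int r))"
proof -
  define q where "q = \<Prod>(R \<union> T)"
  define X where "X a = quad_char R a * quad_char T a" for a
  have q: "q > 0" unfolding q_def using assms by (intro odd_primes_pos odd_primes_Un)
  have perX: "periodic q X" unfolding q_def X_def[abs_def] by (rule periodic_pair[OF assms(1,2)])
  have C: "pair_corr R T h = (\<Sum>a<q. X (int a) * X (int a + h))" for h
    by (simp add: pair_corr_def q_def X_def)
  have corr: "(\<Sum>a<q. X (int a + int k) * X (int a + int l)) = pair_corr R T (int l + - int k)" for k l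
  proof -
    have "periodic q (\<lambda>a. X a * X (a + (int l + - int k)))"
      by (intro periodic_mult periodic_shift perX)
    from sum_periodic_shift[OF this q, of "int k"] show ?thesis
      unfolding C by (simp add: add.assoc)
  qed
  have perC: "periodic q (\<lambda>h. \<bar>pair_corr R T h\<bar>)"
    using perX by (simp add: periodic_def C add.assoc[symmetric])
  have "(\<Sum>a<q. (\<Sum>l<L. X (int a + int l))\<^sup>2) =
      (\<Sum>a<q. \<Sum>k<L. \<Sum>l<L. X (int a + int k) * X (int a + int l))"
    by (simp add: power2_eq_square sum_product)
  also have "\<dots> = (\<Sum>k<L. \<Sum>a<q. \<Sum>l<L. X (int a + int k) * X (int a + int l))"
    by (rule sum.swap)
  also have "\<dots> = (\<Sum>k<L. \<Sum>l<L. \<Sum>a<q. X (int a + int k) * X (int a + int l))"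
    by (intro sum.cong refl sum.swap)
  also have "\<dots> = (\<Sum>k<L. \<Sum>l<L. pair_corr R T (int l + - int k))" by (simp only: corr)
  also have "\<dots> \<le> (\<Sum>k<L. \<Sum>l<q. \<bar>pair_corr R T (int l + - int k)\<bar>)"
  proof (rule sum_mono)
    fix k
    have "(\<Sum>l<L. pair_corr R T (int l + - int k)) \<le> (\<Sum>l<L. \<bar>pair_corr R T (int l + - int k)\<bar>)"
      by (intro sum_mono abs_ge_self)
    also have "\<dots> \<le> (\<Sum>l<q. \<bar>pair_corr R T (int l + - int k)\<bar>)"
      using assms(3) by (intro sum_mono2) (auto simp: q_def)
    finally show "(\<Sum>l<L. pair_corr R T (int l + - int k)) \<le> (\<Sum>l<q. \<bar>pair_corr R T (int l + - int k)\<bar>)" .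
  qed
  also have "\<dots> = int L * (\<Sum>l<q. \<bar>pair_corr R T (int l)\<bar>)"
    by (simp add: sum_periodic_shift[OF perC q, where h = "- int _"] del: add_uminus_conv_diff)
  also have "\<dots> \<le> int q * ((\<Prod>r\<in>R. 2 * int r) * (\<Prod>r\<in>T. 2 * int r))"
    using assms(3) sum_abs_pair_corr[OF assms(1,2)] unfolding q_def[symmetric]
    by (intro mult_mono) (auto intro: sum_nonneg)
  finally show ?thesis by (simp add: q_def X_def)
qed

text \<open>Some prime lies in exactly one of the two sets, and its local factor has sum
  zero.\<close>

lemma sum_pair_eq_0:
  assumes "odd_primes R" "odd_primes T" "R \<noteq> T"
  shows "(\<Sum>a<\<Prod>(R \<union> T). quad_char R (int a) * quad_char T (int a)) = 0"
proof -
  have "(\<Sum>a<\<Prod>(R \<union> T). quad_char R (int a) * quad_char T (int a))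
      = (\<Prod>r\<in>R \<union> T. \<Sum>a<r. pair_factor R T r (int a))"
    unfolding quad_char_pair_eq[OF assms(1,2)]
    using odd_primes_Un[OF assms(1,2)]
    by (intro sum_prod_periodic periodic_pair_factor) (auto simp: odd_primes_def)
  also obtain r where r: "r \<in> R \<union> T" "\<not> (r \<in> R \<and> r \<in> T)" using assms(3) by blast
  then have "pair_factor R T r = (\<lambda>a. Legendre a (int r))"
    by (auto simp: pair_factor_def fun_eq_iff)
  with r assms have "(\<Sum>a<r. pair_factor R T r (int a)) = 0"
    by (auto simp: odd_primes_def intro!: sum_Legendre)
  with r assms have "(\<Prod>r\<in>R \<union> T. \<Sum>a<r. pair_factor R T r (int a)) = 0"
    by (intro prod_zero) (auto simp: odd_primes_def)
  finally show ?thesis .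
qed

text \<open>Averaging over at least one full period of shifts replaces the Polya-Vinogradov inequality:
  only the second moment over shifts is needed, and no Gauss sums.\<close>

lemma smoothed_pair_sum:
  assumes "odd_primes R" "odd_primes T" "R \<noteq> T" "\<Prod>(R \<union> T) \<le> H"
  shows "(\<Sum>h<H. \<Sum>l<L. quad_char R (int h + int l + x) * quad_char T (int h + int l + x))\<^sup>2
    \<le> 2 * (int H)\<^sup>2 * ((\<Prod>r\<in>R. 2 * int r) * (\<Prod>r\<in>T. 2 * int r))"
proof -
  define q where "q = \<Prod>(R \<union> T)"
  define B where "B = (\<Prod>r\<in>R. 2 * int r) * (\<Prod>r\<in>T. 2 * int r)"
  define X where "X a = quad_char R a * quad_char T a" for a
  have q: "q > 0" unfolding q_def using assms by (intro odd_primes_pos odd_primes_Un)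
  have B: "B \<ge> 0" by (simp add: B_def prod_nonneg)
  have perX: "periodic q X" unfolding q_def X_def[abs_def] by (rule periodic_pair[OF assms(1,2)])
  \<comment> \<open>Complete periods of the inner sum vanish, so only \<open>L mod q\<close> terms
    remain; this is less than the period, as the second moment bound requires.\<close>
  define J where "J h = (\<Sum>l<L mod q. X (h + int l))" for h
  have perJ: "periodic q (\<lambda>h. (J (h + x))\<^sup>2)" "periodic q (\<lambda>h. (J h)\<^sup>2)"
  proof -
    have "X (h + int q + x + l) = X (h + x + l)" "X (h + int q + l) = X (h + l)" for h l
      using periodic_plus_mult[OF perX, of "h + x + l" 1] periodic_plus_mult[OF perX, of "h + l" 1]
      by (simp_all add: algebra_simps)
    then show "periodic q (\<lambda>h. (J (h + x))\<^sup>2)" "periodic q (\<lambda>h. (J h)\<^sup>2)"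
      by (simp_all add: periodic_def J_def)
  qed
  have inner: "(\<Sum>l<L. X (int h + int l + x)) = J (int h + x)" for h
  proof -
    have per: "periodic q (\<lambda>a. X (a + (int h + x)))"
      by (intro periodic_shift perX)
    have "(\<Sum>a<q. X (int a + (int h + x))) = 0"
      using sum_periodic_shift[OF perX q] sum_pair_eq_0[OF assms(1-3)] by (simp add: X_def q_def)
    then show ?thesis
      using sum_periodic_split[OF per q, of L] by (simp add: J_def algebra_simps)
  qed
  have "(\<Sum>h<H. J (int h + x))\<^sup>2 \<le> (\<Sum>h<H. (J (int h + x))\<^sup>2) * int H"
  proof -
    have "(\<Sum>h<H. real_of_int (J (int h + x)))\<^sup>2 \<le> (\<Sum>h<H. (real_of_int (J (int h + x)))\<^sup>2) * real H"
      using sum_squared_le_sum_of_squares[of "\<lambda>h. real_of_int (J (int h + x))" "{..<H}"] by simp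
    then have "real_of_int ((\<Sum>h<H. J (int h + x))\<^sup>2) \<le> real_of_int ((\<Sum>h<H. (J (int h + x))\<^sup>2) * int H)"
      by simp
    then show ?thesis by (simp only: of_int_le_iff)
  qed
  also have "(\<Sum>h<H. (J (int h + x))\<^sup>2) \<le> int (H div q + 1) * (\<Sum>a<q. (J (int a))\<^sup>2)"
  proof -
    have "(\<Sum>h<H mod q. (J (int h + x))\<^sup>2) \<le> (\<Sum>h<q. (J (int h + x))\<^sup>2)"
      using q by (intro sum_mono2) (auto simp: less_imp_le)
    then show ?thesis
      using sum_periodic_split[OF perJ(1) q, of H] sum_periodic_shift[OF perJ(2) q, of x]
      by (simp add: algebra_simps)
  qed
  also have "(\<Sum>a<q. (J (int a))\<^sup>2) \<le> int q * B"
    using second_moment_shifts[OF assms(1,2), of "L mod q"] q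
    by (simp add: J_def q_def X_def B_def less_imp_le)
  also have "int (H div q + 1) * (int q * B) = int ((H div q) * q + q) * B"
    by (simp add: algebra_simps)
  \<comment> \<open>Rounding up to whole periods at most doubles the length because
    \<open>q \<le> H\<close>. With moduli up to \<open>S * S\<close> this is where
    \<open>S \<le> Z\<close> will be needed.\<close>
  also have "int ((H div q) * q + q) \<le> int (2 * H)"
    using assms(4) unfolding q_def[symmetric] of_nat_le_iff
    using div_times_less_eq_dividend[of H q] by linarith
  finally have "(\<Sum>h<H. J (int h + x))\<^sup>2 \<le> int (2 * H) * B * int H"
    using B by (simp add: mult_right_mono)
  then show ?thesis using inner by (simp add: X_def B_def power2_eq_square ac_simps)
qed

text \<open>The summand is a square, so the interval up to \<open>M\<close> may be enlarged to the
  windows from \<open>h - M\<close> to \<open>h + M\<close>, which contain it for every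
  \<open>h < M\<close>. Averaging over \<open>h\<close> produces the sums of
  \<open>smoothed_pair_sum\<close> for pairs with distinct prime sets; \<open>few\<close> limits the
  remaining pairs.\<close>

lemma large_sieve_quad_char:
  fixes R :: "'s \<Rightarrow> nat set" and B :: real
  assumes "finite A" "M > 0"
    and odd: "\<And>s. s \<in> A \<Longrightarrow> odd_primes (R s)"
    and le_M: "\<And>s t. s \<in> A \<Longrightarrow> t \<in> A \<Longrightarrow> \<Prod>(R s \<union> R t) \<le> M"
    and le_B: "\<And>s. s \<in> A \<Longrightarrow> (\<Prod>r\<in>R s. 2 * real r) \<le> B"
    and few: "\<And>s. s \<in> A \<Longrightarrow> card {t\<in>A. R s = R t} \<le> 2"
  shows "(\<Sum>m\<le>M. (\<Sum>s\<in>A. real_of_int (quad_char (R s) (int m)))\<^sup>2)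
    \<le> 2 * real (card A) * real (2 * M + 1) + sqrt 2 * B * (real (card A))\<^sup>2"
proof -
  define F where "F m = (\<Sum>s\<in>A. real_of_int (quad_char (R s) m))\<^sup>2" for m
  define U where "U s t = (\<Sum>h<M. \<Sum>l<2*M+1. real_of_int
     (quad_char (R s) (int h + int l + - int M) * quad_char (R t) (int h + int l + - int M)))" for s t
  have U_diag: "U s t \<le> real M * real (2 * M + 1)" for s t
  proof -
    have "U s t \<le> (\<Sum>h<M. \<Sum>l<2*M+1. 1)" unfolding U_def
    proof (intro sum_mono)
      fix h l :: nat
      let ?z = "int h + int l + - int M"
      have "\<bar>quad_char (R s) ?z * quad_char (R t) ?z\<bar> \<le> 1"
        unfolding abs_mult by (intro mult_le_one abs_quad_char_le) auto
      then show "real_of_int (quad_char (R s) ?z * quad_char (R t) ?z) \<le> 1" by linarith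
    qed
    then show ?thesis by simp
  qed
  have U_off: "U s t \<le> sqrt 2 * real M * B" if "s \<in> A" "t \<in> A" "R s \<noteq> R t" for s t
  proof -
    have B0: "0 \<le> (\<Prod>r\<in>R s. 2 * real r)" "0 \<le> (\<Prod>r\<in>R t. 2 * real r)"
      by (auto intro: prod_nonneg)
    have "real_of_int ((\<Sum>h<M. \<Sum>l<2*M+1.
       quad_char (R s) (int h + int l + - int M) * quad_char (R t) (int h + int l + - int M))\<^sup>2)
       \<le> real_of_int (2 * (int M)\<^sup>2 * ((\<Prod>r\<in>R s. 2 * int r) * (\<Prod>r\<in>R t. 2 * int r)))"
      unfolding of_int_le_iff using odd le_M that by (intro smoothed_pair_sum) auto
    then have "(U s t)\<^sup>2 \<le> 2 * (real M)\<^sup>2 * ((\<Prod>r\<in>R s. 2 * real r) * (\<Prod>r\<in>R t. 2 * real r))"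
      unfolding U_def by (simp del: add_uminus_conv_diff)
    also have "\<dots> \<le> 2 * (real M)\<^sup>2 * (B * B)"
      using le_B[OF that(1)] le_B[OF that(2)] B0
      by (intro mult_left_mono mult_mono) auto
    also have "\<dots> = (sqrt 2 * real M * B)\<^sup>2"
      by (simp add: power_mult_distrib power2_eq_square[of B])
    finally have "\<bar>U s t\<bar> \<le> \<bar>sqrt 2 * real M * B\<bar>"
      by (simp only: abs_le_square_iff)
    moreover have "B \<ge> 0" using le_B[OF that(1)] B0 by linarith
    ultimately show ?thesis by (simp add: abs_mult)
  qed
  have "real M * (\<Sum>m\<le>M. F (int m)) = (\<Sum>h<M. \<Sum>m\<le>M. F (int m))" by simp
  also have "\<dots> \<le> (\<Sum>h<M. \<Sum>l<2*M+1. F (int h + int l + - int M))"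
  proof (intro sum_mono)
    fix h assume "h \<in> {..<M}"
    then have h: "h < M" by simp
    have "(\<Sum>m\<le>M. F (int m)) = (\<Sum>l\<in>(\<lambda>m. m + (M - h)) ` {..M}. F (int h + int l + - int M))"
    proof (subst sum.reindex)
      show "inj_on (\<lambda>m. m + (M - h)) {..M}" by (auto intro: inj_onI)
      have "int h + int (m + (M - h)) + - int M = int m" for m using h by (simp add: of_nat_diff)
      then show "(\<Sum>m\<le>M. F (int m)) = sum ((\<lambda>l. F (int h + int l + - int M)) \<circ> (\<lambda>m. m + (M - h))) {..M}"
        by (simp only: o_def)
    qed
    also have "\<dots> \<le> (\<Sum>l<2*M+1. F (int h + int l + - int M))"
      using h by (intro sum_mono2) (auto simp: F_def)
    finally show "(\<Sum>m\<le>M. F (int m)) \<le> (\<Sum>l<2*M+1. F (int h + int l + - int M))" .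
  qed
  also have "\<dots> = (\<Sum>h<M. \<Sum>l<2*M+1. \<Sum>s\<in>A. \<Sum>t\<in>A. real_of_int
     (quad_char (R s) (int h + int l + - int M) * quad_char (R t) (int h + int l + - int M)))"
    by (simp add: F_def power2_eq_square sum_product)
  also have "\<dots> = (\<Sum>h<M. \<Sum>s\<in>A. \<Sum>t\<in>A. \<Sum>l<2*M+1. real_of_int
     (quad_char (R s) (int h + int l + - int M) * quad_char (R t) (int h + int l + - int M)))"
    apply (intro sum.cong refl)
    apply (rule trans[OF sum.swap])
    apply (intro sum.cong refl)
    apply (rule sum.swap)
    done
  also have "\<dots> = (\<Sum>s\<in>A. \<Sum>t\<in>A. U s t)"
    unfolding U_def
    apply (rule trans[OF sum.swap])
    apply (intro sum.cong refl)
    apply (rule sum.swap)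
    done
  also have "\<dots> \<le> (\<Sum>s\<in>A. \<Sum>t\<in>A. (if R s = R t then real M * real (2 * M + 1) else 0) + sqrt 2 * real M * B)"
  proof (intro sum_mono)
    fix s t assume st: "s \<in> A" "t \<in> A"
    have "B \<ge> 0" using le_B[OF st(1)] by (rule order_trans[rotated]) (simp add: prod_nonneg)
    then show "U s t \<le> (if R s = R t then real M * real (2 * M + 1) else 0) + sqrt 2 * real M * B"
      using U_off[OF st] U_diag[of s t] by (cases "R s = R t") (auto intro: add_increasing2)
  qed
  also have "\<dots> = (\<Sum>s\<in>A. real (card {t\<in>A. R s = R t}) * (real M * real (2 * M + 1))
       + real (card A) * (sqrt 2 * real M * B))"
    using assms(1) by (simp add: sum.distrib sum.If_cases Int_def)
  also have "\<dots> \<le> (\<Sum>s\<in>A. 2 * (real M * real (2 * M + 1)) + real (card A) * (sqrt 2 * real M * B))"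
  proof (intro sum_mono add_right_mono mult_right_mono)
    fix s assume "s \<in> A"
    from few[OF this] show "real (card {t\<in>A. R s = R t}) \<le> 2" by linarith
  qed auto
  also have "\<dots> = real M * (2 * real (card A) * real (2 * M + 1) + sqrt 2 * B * (real (card A))\<^sup>2)"
    by (simp add: algebra_simps power2_eq_square)
  finally show ?thesis using assms(2) by (simp add: F_def)
qed

section \<open>A lower bound for the number of primes\<close>

text \<open>The reciprocals \<open>1 / (m * (n choose m))\<close> are the entries of Leibniz' harmonic triangle, so each is
  a difference of two entries one column to the left.\<close>

lemma mult_binomial_dvd:
  assumes "\<And>j. j \<in> {1..N} \<Longrightarrow> j dvd A" "1 \<le> m" "m \<le> n" "n \<le> N"
  shows "m * (n choose m) dvd (A::nat)"
  using assms(2-4)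
proof (induction m arbitrary: n rule: nat_induct_at_least)
  case base
  then show ?case using assms(1)[of n] by simp
next
  case (Suc m)
  have "m * (n - 1 choose m) dvd A" "m * (n choose m) dvd A"
    using Suc by (intro Suc.IH; simp)+
  then obtain k l where k: "A = m * (n - 1 choose m) * k" and l: "A = m * (n choose m) * l"
    unfolding dvd_def by blast
  have absorb: "int n * int (n - 1 choose m) = (int n - int m) * int (n choose m)"
    using binomial_absorb_comp[of n m] Suc.prems
    by (metis Suc_leD of_nat_diff of_nat_mult)
  \<comment> \<open>The quotient sought is \<open>k - l\<close>, the difference of two quotients
    from the previous column; a factor \<open>m\<close> on both sides keeps the computation in the
    integers.\<close>
  have "int m * int (Suc m * (n choose Suc m)) * (int k - int l) =
      int m * (int n * int (n - 1 choose m)) * (int k - int l)"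
    by (simp only: binomial_absorption of_nat_mult mult.assoc)
  also have "\<dots> = int n * (int m * int (n - 1 choose m) * int k)
      - (int n - int m) * (int m * int (n choose m) * int l)"
    unfolding right_diff_distrib by (subst (2) absorb) (simp add: algebra_simps)
  also have "\<dots> = int m * int A"
    using k l by (metis (no_types, opaque_lifting) diff_diff_eq2 left_diff_distrib' of_nat_mult add_diff_cancel_left')
  finally have "int A = int (Suc m * (n choose Suc m)) * (int k - int l)"
    using Suc.hyps by (simp only: mult.assoc mult_cancel_left) simp
  then have "int (Suc m * (n choose Suc m)) dvd int A" by (rule dvdI)
  then show ?case by (simp only: of_nat_dvd_iff)
qed

text \<open>\<open>A\<close>, the product of the largest prime powers not exceeding
  \<open>N\<close>, is the least common multiple of \<open>{1..N}\<close>. It is at most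
  \<open>N\<close> to the number of primes, and it is divisible by \<open>n\<close> times the
  central binomial coefficient, which is at least half of \<open>4 ^ n\<close>.\<close>

lemma four_power_le_primes:
  assumes "n \<ge> 1"
  shows "(4::real) ^ n \<le> 2 * real (2 * n) ^ card {p. prime p \<and> p \<le> 2 * n}"
proof -
  define N where "N = 2 * n"
  define P where "P = {p. prime p \<and> p \<le> N}"
  have fin: "finite P" unfolding P_def by (rule finite_subset[of _ "{..N}"]) auto
  have "\<forall>p\<in>P. \<exists>k. p ^ k \<le> N \<and> N < p ^ (k + 1)"
    using assms ex_power_ivl1[of _ N] prime_ge_2_nat by (auto simp: P_def N_def)
  then obtain k where k: "\<And>p. p \<in> P \<Longrightarrow> p ^ k p \<le> N \<and> N < p ^ (k p + 1)" by metis
  define A where "A = (\<Prod>p\<in>P. p ^ k p)"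
  have "j dvd A" if "j \<in> {1..N}" for j
  proof -
    have "(\<Prod>p\<in>prime_factors j. p ^ multiplicity p j) dvd A" unfolding A_def
    proof (rule prod_dvd_prod_subset2[OF fin])
      show sub: "prime_factors j \<subseteq> P"
        using that by (auto simp: P_def in_prime_factors_iff dest!: dvd_imp_le)
      fix p assume p: "p \<in> prime_factors j"
      have "p ^ multiplicity p j dvd j" by (rule multiplicity_dvd)
      then have "p ^ multiplicity p j \<le> N" using that by (auto dest!: dvd_imp_le)
      then have "p ^ multiplicity p j < p ^ (k p + 1)" using k[of p] sub p by force
      then have "multiplicity p j < k p + 1"
        using p by (subst (asm) power_strict_increasing_iff) (auto simp: in_prime_factors_iff dest: prime_gt_1_nat)
      then show "p ^ multiplicity p j dvd p ^ k p" by (intro le_imp_power_dvd) simp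
    qed
    then show ?thesis using that by (simp add: prime_factorization_nat[symmetric])
  qed
  then have "n * (2 * n choose n) dvd A"
    using assms by (intro mult_binomial_dvd[of N]) (auto simp: N_def)
  moreover have "A > 0" by (auto simp: A_def P_def intro!: prod_pos dest: prime_gt_0_nat)
  ultimately have "n * (2 * n choose n) \<le> A" by (rule dvd_imp_le)
  also have "A \<le> (\<Prod>p\<in>P. N)" unfolding A_def using k by (intro prod_mono) auto
  also have "\<dots> = N ^ card P" by simp
  finally have "real n * real (2 * n choose n) \<le> real N ^ card P"
    by (metis of_nat_le_iff of_nat_mult of_nat_power)
  moreover have "4 ^ n \<le> 2 * (real n * real (2 * n choose n))"
    using central_binomial_lower_bound[of n] assms by (simp add: field_simps)
  ultimately show ?thesis unfolding N_def P_def by linarith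
qed

text \<open>Of the 2 subtracted from \<open>Z\<close>, one comes from rounding \<open>Z\<close> to
  the even number \<open>2 * n\<close>, the other from the factor 2 in
  \<open>four_power_le_primes\<close>.\<close>

lemma card_primes_ge:
  assumes "Z \<ge> 2"
  shows "(real Z - 2) * ln 2 / ln (real Z) \<le> real (card {p. prime p \<and> p \<le> Z})"
proof -
  define n where "n = Z div 2"
  define k where "k = card {p. prime p \<and> p \<le> Z}"
  have n: "n \<ge> 1" "2 * n \<le> Z" "Z \<le> 2 * n + 1" using assms by (auto simp: n_def)
  have "finite {p. prime p \<and> p \<le> Z}" by (rule finite_subset[of _ "{..Z}"]) auto
  then have "card {p. prime p \<and> p \<le> 2 * n} \<le> k"
    unfolding k_def using n by (intro card_mono) auto
  then have "2 * real (2 * n) ^ card {p. prime p \<and> p \<le> 2 * n} \<le> 2 * real Z ^ k"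
    using n by (intro mult_left_mono order_trans[OF power_increasing power_mono]) auto
  with four_power_le_primes[OF n(1)] have "4 ^ n \<le> 2 * real Z ^ k" by linarith
  then have "ln (4 ^ n) \<le> ln (2 * real Z ^ k)" using assms by (subst ln_le_cancel_iff) auto
  then have "real n * ln 4 \<le> ln 2 + real k * ln (real Z)"
    using assms by (simp add: ln_mult ln_realpow)
  moreover have "ln (4::real) = 2 * ln 2" using ln_realpow[of 2 2] by simp
  moreover have "(real Z - 1) * ln 2 \<le> (2 * real n) * ln 2"
    using n by (intro mult_right_mono) auto
  ultimately have "(real Z - 2) * ln 2 \<le> real k * ln (real Z)" by (simp add: algebra_simps)
  then show ?thesis using assms by (simp add: k_def divide_le_eq)
qed

text \<open>The factor 4 and the summand 1 anticipate the choice of one of four classes and the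
  removal of the prime 2.\<close>

lemma eventually_card_primes_ge:
  assumes "\<delta> > 0" "\<delta> < 1"
  shows "eventually (\<lambda>Z. 4 * real Z powr (1 - \<delta>) + 1 \<le> real (card {p. prime p \<and> p \<le> Z})) sequentially"
proof -
  have "eventually (\<lambda>Z. 4 * real Z powr (1 - \<delta>) + 1 \<le> (real Z - 2) * ln 2 / ln (real Z)) sequentially"
    using assms by real_asymp
  then show ?thesis using eventually_ge_at_top[of 2]
    by eventually_elim (rule order_trans[OF _ card_primes_ge])
qed

section \<open>Numbers of prime factors\<close>

lemma prod_prime_factors_le:
  assumes "n > (0::nat)"
  shows "\<Prod>(prime_factors n) \<le> n"
proof -
  have "\<Prod>(prime_factors n) dvd (\<Prod>p\<in>prime_factors n. p ^ multiplicity p n)"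
  proof (rule prod_dvd_prod)
    fix p assume "p \<in> prime_factors n"
    then have "multiplicity p n > 0"
      by (simp add: prime_factors_multiplicity)
    then show "p dvd p ^ multiplicity p n" by (simp add: dvd_power)
  qed
  then show ?thesis using assms by (auto simp: prime_factorization_nat[symmetric] dest: dvd_imp_le)
qed

lemma two_power_card_prime_factors_le:
  assumes "n > (0::nat)"
  shows "2 ^ card (prime_factors n) \<le> n"
proof -
  have "(\<Prod>p\<in>prime_factors n. 2) \<le> \<Prod>(prime_factors n)"
    by (intro prod_mono) (auto simp: in_prime_factors_iff dest: prime_ge_2_nat)
  with prod_prime_factors_le[OF assms] show ?thesis by simp
qed

text \<open>A prime \<open>p > 2 powr (1 / \<delta>)\<close> has
  \<open>p powr \<delta> \<ge> 2\<close> and costs nothing. Each of the finitely many smaller primes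
  costs at most a factor 2.\<close>

lemma ex_two_power_card_prime_factors_le:
  assumes "\<delta> > 0"
  shows "\<exists>C\<ge>1. \<forall>n>0. 2 ^ card (prime_factors n) \<le> C * real n powr \<delta>"
proof -
  define T where "T = (2::real) powr (1 / \<delta>)"
  define B where "B = {p::nat. real p \<le> T}"
  have finB: "finite B" unfolding B_def
    by (rule finite_subset[of _ "{..nat \<lfloor>T\<rfloor>}"]) (auto simp: le_nat_floor)
  have "2 ^ card (prime_factors n) \<le> 2 ^ card B * real n powr \<delta>" if n: "n > 0" for n
  proof -
    have "(2::real) ^ card (prime_factors n) = (\<Prod>p\<in>prime_factors n. 2)" by simp
    also have "\<dots> \<le> (\<Prod>p\<in>prime_factors n. (if p \<in> B then 2 else 1) * real p powr \<delta>)"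
    proof (intro prod_mono conjI)
      fix p assume "p \<in> prime_factors n"
      then have p: "real p \<ge> 1" by (auto simp: in_prime_factors_iff dest: prime_gt_0_nat)
      show "2 \<le> (if p \<in> B then 2 else 1) * real p powr \<delta>"
      proof (cases "p \<in> B")
        case True
        then show ?thesis using p assms by (simp add: ge_one_powr_ge_zero)
      next
        case False
        then have "T powr \<delta> \<le> real p powr \<delta>"
          using assms by (intro powr_mono2) (auto simp: B_def T_def)
        then show ?thesis using False assms by (simp add: T_def powr_powr)
      qed
    qed auto
    also have "\<dots> = 2 ^ card (prime_factors n \<inter> B) * (\<Prod>p\<in>prime_factors n. real p powr \<delta>)"
      by (simp add: prod.distrib prod.If_cases Int_def)
    also have "(\<Prod>p\<in>prime_factors n. real p powr \<delta>) = real (\<Prod>(prime_factors n)) powr \<delta>"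
      by (simp add: prod_powr_distrib)
    also have "2 ^ card (prime_factors n \<inter> B) * real (\<Prod>(prime_factors n)) powr \<delta> \<le> 2 ^ card B * real n powr \<delta>"
    proof (intro mult_mono power_increasing card_mono powr_mono2)
      show "real (\<Prod>(prime_factors n)) \<le> real n"
        using prod_prime_factors_le[OF n] by (simp only: of_nat_le_iff)
      show "0 \<le> real (\<Prod>(prime_factors n))" by (simp only: of_nat_0_le_iff)
    qed (use assms finB in auto)
    finally show ?thesis .
  qed
  then show ?thesis by (intro exI[of _ "2 ^ card B"]) auto
qed

section \<open>Primitivity and reciprocity\<close>

lemma quad_char_neq_0_iff:
  assumes "odd_primes R"
  shows "quad_char R a \<noteq> 0 \<longleftrightarrow> coprime a (int (\<Prod>R))"
proof -
  have "quad_char R a \<noteq> 0 \<longleftrightarrow> (\<forall>r\<in>R. \<not> int r dvd a)"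
    using assms by (simp add: quad_char_def odd_primes_def Legendre_eq_0_iff)
  also have "\<dots> \<longleftrightarrow> (\<forall>r\<in>R. coprime a (int r))"
  proof (intro ball_cong refl)
    fix r assume "r \<in> R"
    then have "prime (int r)" using assms by (simp add: odd_primes_def)
    then show "\<not> int r dvd a \<longleftrightarrow> coprime a (int r)"
      by (metis coprime_commute coprime_absorb_left not_prime_unit prime_imp_coprime)
  qed
  also have "\<dots> \<longleftrightarrow> coprime a (int (\<Prod>R))"
  proof
    assume "coprime a (int (\<Prod>R))"
    then show "\<forall>r\<in>R. coprime a (int r)"
      using assms dvd_prodI[of R _ int]
      by (auto simp: odd_primes_def intro: coprime_divisors[OF dvd_refl])
  qed (simp add: prod_coprime_right)
  finally show ?thesis .
qed

lemma quad_char_1: "odd_primes R \<Longrightarrow> quad_char R 1 = 1"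
  by (simp add: quad_char_def odd_primes_def)

lemma quad_char_dirichlet:
  assumes "odd_primes R"
  shows "dirichlet_character (\<Prod>R) (\<lambda>a. of_int (quad_char R a))"
  using periodic_quad_char[OF assms] quad_char_neq_0_iff[OF assms] odd_primes_pos[OF assms]
  by (simp add: dirichlet_character_def quad_char_mult[OF assms] quad_char_1[OF assms] periodic_def)

text \<open>If the character came from a proper divisor \<open>d\<close>, some \<open>r\<close> in
  \<open>R\<close> would not divide \<open>d\<close>, so \<open>d\<close> would divide the cofactor
  \<open>Q\<close>. A number that is a nonresidue modulo \<open>r\<close> and 1 modulo
  \<open>Q\<close> has character value -1 but is 1 modulo \<open>d\<close>.\<close>

lemma quad_char_primitive:
  assumes "odd_primes R"
  shows "primitive_character (\<Prod>R) (\<lambda>a. of_int (quad_char R a))"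
  unfolding primitive_character_def
proof (intro conjI notI quad_char_dirichlet[OF assms], elim exE conjE)
  fix d psi
  assume d: "d dvd \<Prod>R" "d < \<Prod>R" and psi: "dirichlet_character d psi"
    and eq: "\<forall>a. coprime a (int (\<Prod>R)) \<longrightarrow> complex_of_int (quad_char R a) = psi a"
  have fin: "finite R" and pr: "\<And>r. r \<in> R \<Longrightarrow> prime r \<and> 2 < r" using assms by (auto simp: odd_primes_def)
  have "\<exists>r\<in>R. \<not> r dvd d"
  proof (rule ccontr)
    assume "\<not> (\<exists>r\<in>R. \<not> r dvd d)"
    then have "[d = 0] (mod (\<Prod>r\<in>R. r))"
      using pr by (intro coprime_cong_prod_nat) (auto simp: cong_0_iff intro: primes_coprime)
    then have "\<Prod>R dvd d" by (simp add: cong_0_iff)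
    then show False using d psi by (auto simp: dirichlet_character_def dest: dvd_imp_le)
  qed
  then obtain r where r: "r \<in> R" "\<not> r dvd d" by blast
  define Q where "Q = \<Prod>(R - {r})"
  have prod: "\<Prod>R = r * Q" unfolding Q_def using fin r by (simp add: prod.remove)
  have "coprime d r" using r pr[OF r(1)] by (metis coprime_commute prime_imp_coprime)
  then have dQ: "d dvd Q" using d(1) unfolding prod by (simp add: coprime_dvd_mult_right_iff)
  obtain b where b: "Legendre b (int r) = -1" using ex_nonresidue r pr by blast
  have "coprime (int r) (int Q)"
    unfolding Q_def coprime_int_iff using r pr by (intro coprime_prod_set_primes) auto
  then obtain a where a: "[a = b] (mod int r)" "[a = 1] (mod int Q)"
    using binary_chinese_remainder_int by blast
  have "Legendre a (int t) = 1" if "t \<in> R - {r}" for t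
  proof -
    have "t dvd Q" unfolding Q_def using that fin dvd_prodI[of "R - {r}" t "\<lambda>x. x"] by simp
    then have "[a = 1] (mod int t)" using a(2) by (metis cong_dvd_modulus of_nat_dvd_iff)
    then show ?thesis using Legendre_cong[of a 1] that pr by auto
  qed
  moreover have "Legendre a (int r) = -1" using Legendre_cong[OF a(1)] b by simp
  ultimately have X: "quad_char R a = -1"
    unfolding quad_char_def using fin r by (simp add: prod.remove)
  then have "psi a = -1" using eq quad_char_neq_0_iff[OF assms, of a] by auto
  moreover have "periodic d psi" using psi by (simp add: dirichlet_character_def periodic_def)
  then have "psi a = psi 1"
    using a(2) dQ by (intro periodic_cong[of d]) (auto intro: cong_dvd_modulus)
  ultimately show False using psi by (simp add: dirichlet_character_def)
qed

text \<open>Swapping \<open>r\<close> with \<open>p\<close> and with \<open>q\<close> produces the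
  same sign twice because \<open>p\<close> and \<open>q\<close> agree modulo 4. If \<open>r\<close>
  is one of them, both sides are 0.\<close>

lemma Legendre_reciprocity_pair:
  assumes "prime p" "2 < p" "prime q" "2 < q" "p \<noteq> q" "[p = q] (mod 4)" "prime r" "2 < r"
  shows "Legendre (int r) (int p) * Legendre (int r) (int q) = Legendre (int p * int q) (int r)"
proof (cases "r = p \<or> r = q")
  case True
  then have "Legendre (int r) (int p) * Legendre (int r) (int q) = 0"
    by (auto simp: Legendre_eq_0_iff)
  moreover have "Legendre (int p * int q) (int r) = 0"
    using True by (auto simp: Legendre_eq_0_iff)
  ultimately show ?thesis by simp
next
  case False
  define e :: "nat \<Rightarrow> int" where "e x = (-1) ^ ((r - 1) div 2 * ((x - 1) div 2))" for x
  have sq: "Legendre (int x) (int r) * Legendre (int x) (int r) = 1" if "prime x" "r \<noteq> x" for x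
  proof -
    have "\<not> int r dvd int x" using that assms(7) primes_dvd_imp_eq by auto
    then have "Legendre (int x) (int r) \<noteq> 0" by (simp add: Legendre_eq_0_iff)
    then show ?thesis using Legendre_cases[of "int x" "int r"] by auto
  qed
  have flip: "Legendre (int r) (int x) = e x * Legendre (int x) (int r)"
    if "prime x" "2 < x" "r \<noteq> x" for x
  proof -
    have "Legendre (int r) (int x) * Legendre (int x) (int r) = e x"
      unfolding e_def using that assms by (intro Quadratic_Reciprocity) auto
    then show ?thesis using sq[OF that(1,3)] by (metis mult.assoc mult.right_neutral)
  qed
  have "even ((p - 1) div 2) = even ((q - 1) div 2)"
  proof -
    have "p mod 4 = q mod 4" using assms(6) by (simp add: cong_def)
    moreover have "odd p" "odd q" using assms by (auto simp: prime_odd_nat)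
    ultimately show ?thesis by presburger
  qed
  then have "e p = e q" by (auto simp: e_def minus_one_power_iff)
  moreover have "e q * e q = 1" by (simp add: e_def minus_one_power_iff)
  ultimately show ?thesis
    using False assms by (simp add: flip Legendre_mult mult.assoc mult.left_commute)
qed

lemma squarefree_prod_prime_factors:
  assumes "squarefree (s::nat)"
  shows "\<Prod>(prime_factors s) = s"
proof -
  have "s \<noteq> 0" using assms by (metis not_squarefree_0)
  then have "s = (\<Prod>p\<in>prime_factors s. p ^ multiplicity p s)" by (simp add: prime_factorization_nat)
  also have "\<dots> = \<Prod>(prime_factors s)"
    using assms \<open>s \<noteq> 0\<close> by (intro prod.cong refl) (auto simp: squarefree_factorial_semiring' prime_factors_multiplicity)
  finally show ?thesis by simp
qed

lemma Legendre_prod: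
  assumes "prime p" "2 < p" "finite A"
  shows "Legendre (int (\<Prod>A)) (int p) = (\<Prod>a\<in>A. Legendre (int a) (int p))"
  using assms(3) by (induction rule: finite_induct) (simp_all add: assms Legendre_mult)

text \<open>After the flip the modulus depends on \<open>s\<close> alone and the argument on
  \<open>p * q\<close> alone. The prime 2, outside the reciprocity law, contributes the square of a
  sign because its symbols at \<open>p\<close> and \<open>q\<close> agree.\<close>

lemma quad_char_reciprocity:
  assumes "prime p" "2 < p" "prime q" "2 < q" "p \<noteq> q" "[p = q] (mod 4)"
    and "Legendre 2 (int p) = Legendre 2 (int q)" "squarefree s"
  shows "quad_char {p, q} (int s) = quad_char (prime_factors s - {2}) (int (p * q))"
proof -
  have eq: "Legendre (int s) (int x) = (\<Prod>r\<in>prime_factors s. Legendre (int r) (int x))"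
    if "prime x" "2 < x" for x
    using Legendre_prod[OF that, of "prime_factors s"] by (simp only: squarefree_prod_prime_factors[OF assms(8)] finite_set_mset)
  have "quad_char {p, q} (int s) = (\<Prod>r\<in>prime_factors s. Legendre (int r) (int p) * Legendre (int r) (int q))"
    using assms(5) by (simp add: quad_char_def eq assms prod.distrib)
  also have "\<dots> = (\<Prod>r\<in>prime_factors s - {2}. Legendre (int r) (int p) * Legendre (int r) (int q))"
  proof (rule prod.mono_neutral_right)
    have "Legendre 2 (int q) \<noteq> 0"
      using assms(4) zdvd_not_zless[of 2 "int q"] by (auto simp: Legendre_eq_0_iff)
    then have "Legendre 2 (int q) * Legendre 2 (int q) = 1"
      using Legendre_cases[of 2 "int q"] by auto
    then show "\<forall>r\<in>prime_factors s - (prime_factors s - {2}). Legendre (int r) (int p) * Legendre (int r) (int q) = 1"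
      using assms(7) by auto
  qed auto
  also have "\<dots> = quad_char (prime_factors s - {2}) (int (p * q))"
    unfolding quad_char_def of_nat_mult
  proof (intro prod.cong refl Legendre_reciprocity_pair assms)
    fix r assume r: "r \<in> prime_factors s - {2}"
    then show "prime r" by (auto simp: in_prime_factors_iff)
    then show "2 < r" using r prime_ge_2_nat[of r] by (cases "r = 2") auto
  qed
  finally show ?thesis .
qed

section \<open>The square sieve\<close>

definition dyadic :: "nat \<Rightarrow> nat set" where
  "dyadic N = {n. real N / 2 < real n \<and> n \<le> N}"

definition sqfree_upto :: "real \<Rightarrow> nat set" where
  "sqfree_upto S = {s. s > 0 \<and> real s \<le> S \<and> squarefree s}"

definition dyadic_count :: "real \<Rightarrow> real \<Rightarrow> nat \<Rightarrow> nat" where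
  "dyadic_count c S N =
     (\<Sum>s\<in>sqfree_upto S. card {n\<in>dyadic N. \<exists>m::int. \<lfloor>real n powr c\<rfloor> = int s * m\<^sup>2})"

lemma dyadic_subset: "dyadic N \<subseteq> {1..N}"
  unfolding dyadic_def by (auto simp: Suc_le_eq intro!: Nat.gr0I)

lemma finite_dyadic: "finite (dyadic N)"
  using dyadic_subset finite_subset by blast

lemma card_dyadic_le: "card (dyadic N) \<le> N"
  using card_mono[OF _ dyadic_subset] by fastforce

lemma finite_sqfree_upto: "finite (sqfree_upto S)"
  by (rule finite_subset[of _ "{..nat \<lfloor>S\<rfloor>}"]) (auto simp: sqfree_upto_def le_nat_floor)

lemma card_sqfree_upto_le:
  assumes "S \<ge> 0"
  shows "real (card (sqfree_upto S)) \<le> S"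
proof -
  have "sqfree_upto S \<subseteq> {1..nat \<lfloor>S\<rfloor>}" by (auto simp: sqfree_upto_def le_nat_floor)
  from card_mono[OF _ this] show ?thesis using assms by (simp add: le_nat_iff le_floor_iff)
qed

lemma frak_Q_dyadic: "frak_Q c S N \<le> dyadic_count c S N + frak_Q c S (N div 2)"
proof -
  have "Q_count c s N \<le> card {n\<in>dyadic N. \<exists>m::int. \<lfloor>real n powr c\<rfloor> = int s * m\<^sup>2} + Q_count c s (N div 2)" for s
  proof -
    have "n \<in> dyadic N \<or> n \<in> {1..N div 2}" if "n \<in> {1..N}" for n
    proof (cases "n \<le> N div 2")
      case False
      then have "N < 2 * n" by linarith
      then have "real N < 2 * real n" by (metis of_nat_less_iff of_nat_mult of_nat_numeral)
      then show ?thesis using that by (simp add: dyadic_def)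
    qed (use that in auto)
    then have "{n \<in> {1..N}. \<exists>m::int. \<lfloor>real n powr c\<rfloor> = int s * m\<^sup>2} \<subseteq>
       {n \<in> dyadic N. \<exists>m::int. \<lfloor>real n powr c\<rfloor> = int s * m\<^sup>2} \<union>
       {n \<in> {1..N div 2}. \<exists>m::int. \<lfloor>real n powr c\<rfloor> = int s * m\<^sup>2}" by blast
    then show ?thesis unfolding Q_count_def
      by (intro order_trans[OF card_mono card_Un_le]) (auto simp: finite_dyadic)
  qed
  then show ?thesis
    by (simp add: frak_Q_def dyadic_count_def sqfree_upto_def sum.distrib[symmetric] sum_mono)
qed

lemma floor_powr_bounds:
  assumes "c > 0" "1 \<le> n" "n \<le> N"
  shows "1 \<le> \<lfloor>real n powr c\<rfloor>" "real_of_int \<lfloor>real n powr c\<rfloor> \<le> real N powr c"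
proof -
  show "1 \<le> \<lfloor>real n powr c\<rfloor>" using assms by (simp add: le_floor_iff ge_one_powr_ge_zero)
  have "real_of_int \<lfloor>real n powr c\<rfloor> \<le> real n powr c" by linarith
  also have "\<dots> \<le> real N powr c" using assms by (intro powr_mono2) auto
  finally show "real_of_int \<lfloor>real n powr c\<rfloor> \<le> real N powr c" .
qed

text \<open>At each prime the multiplicity in a squarefree number is 0 or 1, hence determined by its
  parity, which a square factor does not change.\<close>

lemma squarefree_times_square_unique:
  assumes "squarefree s" "squarefree t" "s * k\<^sup>2 = t * l\<^sup>2" "s * k\<^sup>2 > (0::nat)"
  shows "s = t"
proof (rule multiplicity_eq_nat)
  have pos: "s > 0" "t > 0" "k > 0" "l > 0" using assms by (auto intro!: Nat.gr0I)
  then show "s > 0" "t > 0" by simp_all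
  fix p :: nat assume p: "prime p"
  have mult: "multiplicity p (u * v\<^sup>2) = multiplicity p u + 2 * multiplicity p v" if "u > 0" "v > 0" for u v
    using that p by (simp add: prime_elem_multiplicity_mult_distrib prime_elem_multiplicity_power_distrib)
  have "multiplicity p s + 2 * multiplicity p k = multiplicity p t + 2 * multiplicity p l"
    using mult pos assms(3) by metis
  moreover have "multiplicity p s \<le> 1" "multiplicity p t \<le> 1"
    using assms(1,2) p pos by (auto simp: squarefree_factorial_semiring'')
  ultimately show "multiplicity p s = multiplicity p t" by presburger
qed

lemma dyadic_count_le:
  assumes "c > 0"
  shows "dyadic_count c S N \<le> N"
proof -
  define X where "X s = {n\<in>dyadic N. \<exists>m::int. \<lfloor>real n powr c\<rfloor> = int s * m\<^sup>2}" for s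
  have "dyadic_count c S N = card (Sigma (sqfree_upto S) X)"
    unfolding dyadic_count_def X_def
    by (rule card_SigmaI[symmetric]) (auto simp: finite_sqfree_upto finite_dyadic)
  also have "\<dots> \<le> card (dyadic N)"
  proof (rule card_inj_on_le[of snd])
    show "inj_on snd (Sigma (sqfree_upto S) X)"
    proof (rule inj_onI, clarsimp)
      fix s t n assume st: "s \<in> sqfree_upto S" "n \<in> X s" "t \<in> sqfree_upto S" "n \<in> X t"
      then obtain m l where ml: "\<lfloor>real n powr c\<rfloor> = int s * m\<^sup>2" "\<lfloor>real n powr c\<rfloor> = int t * l\<^sup>2"
        unfolding X_def by blast
      have "1 \<le> n" "n \<le> N" using st(2) dyadic_subset[of N] by (auto simp: X_def)
      then have pos: "1 \<le> \<lfloor>real n powr c\<rfloor>" using assms floor_powr_bounds by blast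
      have "int (s * (nat \<bar>m\<bar>)\<^sup>2) = \<lfloor>real n powr c\<rfloor>" "int (t * (nat \<bar>l\<bar>)\<^sup>2) = \<lfloor>real n powr c\<rfloor>"
        using ml by simp_all
      then have "s * (nat \<bar>m\<bar>)\<^sup>2 = t * (nat \<bar>l\<bar>)\<^sup>2" "s * (nat \<bar>m\<bar>)\<^sup>2 > 0"
        using pos by linarith+
      moreover have "squarefree s" "squarefree t" using st by (auto simp: sqfree_upto_def)
      ultimately show "s = t" by (rule squarefree_times_square_unique[rotated 2])
    qed
  qed (auto simp: X_def finite_dyadic)
  also have "\<dots> \<le> N" by (rule card_dyadic_le)
  finally show ?thesis .
qed

text \<open>A number with \<open>k\<close> distinct prime divisors is at least \<open>2 ^ k\<close>.
  The logarithmic count makes the primes dividing the value negligible in the sieve.\<close>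

lemma card_prime_divisors_le:
  assumes "c > 0" "1 \<le> n" "n \<le> N" "\<And>p. p \<in> P \<Longrightarrow> prime p"
  shows "real (card {p\<in>P. int p dvd \<lfloor>real n powr c\<rfloor>}) * ln 2 \<le> c * ln (real N)"
proof -
  define a where "a = nat \<lfloor>real n powr c\<rfloor>"
  have a: "int a = \<lfloor>real n powr c\<rfloor>" "a > 0" "real a \<le> real N powr c"
    using floor_powr_bounds[OF assms(1-3)] by (auto simp: a_def)
  define k where "k = card {p\<in>P. int p dvd \<lfloor>real n powr c\<rfloor>}"
  have "k \<le> card (prime_factors a)" unfolding k_def
    using a assms(4) by (intro card_mono) (auto simp: a(1)[symmetric] in_prime_factors_iff)
  then have "2 ^ k \<le> (2::nat) ^ card (prime_factors a)" by (intro power_increasing) auto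
  also have "\<dots> \<le> a" by (rule two_power_card_prime_factors_le[OF a(2)])
  finally have "(2::real) ^ k \<le> real a" by (metis numeral_power_le_of_nat_cancel_iff)
  also note a(3)
  finally have "ln (2 ^ k) \<le> ln (real N powr c)"
    using assms by (subst ln_le_cancel_iff) auto
  then show ?thesis using assms by (simp add: ln_realpow ln_powr k_def)
qed

lemma square_sieve:
  assumes "c > 0" "finite P" "\<And>p. p \<in> P \<Longrightarrow> prime p \<and> 2 < p"
    and few: "\<And>n. n \<in> dyadic N \<Longrightarrow> 2 * card {p\<in>P. int p dvd \<lfloor>real n powr c\<rfloor>} \<le> card P"
  shows "(real (card P) / 2)\<^sup>2 * real (dyadic_count c S N) \<le>
    (\<Sum>p\<in>P. \<Sum>q\<in>P. (\<Sum>s\<in>sqfree_upto S. real_of_int (Legendre (int s) (int p) * Legendre (int s) (int q))) *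
       (\<Sum>n\<in>dyadic N. real_of_int (Legendre \<lfloor>real n powr c\<rfloor> (int p) * Legendre \<lfloor>real n powr c\<rfloor> (int q))))"
proof -
  define a where "a n = \<lfloor>real n powr c\<rfloor>" for n :: nat
  define V where "V s n = (\<Sum>p\<in>P. real_of_int (Legendre (int s * a n) (int p)))" for s n
  have V_ge: "real (card P) / 2 \<le> V s n"
    if n: "n \<in> dyadic N" and m: "a n = int s * m\<^sup>2" for s n m
  proof -
    \<comment> \<open>A prime dividing \<open>s * m\<close> also divides
      \<open>s * m * m = a n\<close>, so a prime not dividing \<open>a n\<close> gives the square of
      a sign. The other primes contribute nonnegatively, and \<open>few\<close> leaves at least half
      of \<open>P\<close>.\<close>
    have "Legendre (int s * a n) (int p) \<ge> (if int p dvd a n then 0 else 1)" if p: "p \<in> P" for p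
    proof -
      have pp: "prime p" "2 < p" using assms(3) p by auto
      have "int s * a n = (int s * m) * (int s * m)" by (simp add: m power2_eq_square)
      then have eq: "Legendre (int s * a n) (int p) = (Legendre (int s * m) (int p))\<^sup>2"
        by (simp only: Legendre_mult[OF pp] power2_eq_square)
      show ?thesis
      proof (cases "int p dvd a n")
        case False
        then have "\<not> int p dvd int s * m"
          using m by (metis dvd_mult2 mult.assoc power2_eq_square)
        then have "Legendre (int s * m) (int p) \<noteq> 0" by (simp add: Legendre_eq_0_iff)
        then show ?thesis unfolding eq using Legendre_cases[of "int s * m" "int p"] by auto
      qed (simp add: eq)
    qed
    then have "(\<Sum>p\<in>P. if int p dvd a n then 0 else 1) \<le> V s n"
      unfolding V_def by (intro sum_mono) (metis (mono_tags) of_int_0_le_iff of_int_1_le_iff)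
    moreover have "(\<Sum>p\<in>P. if int p dvd a n then 0 else (1::real)) = real (card {p\<in>P. \<not> int p dvd a n})"
      using assms(2) by (simp add: sum.If_cases Int_def)
    moreover have "card P = card {p\<in>P. int p dvd a n} + card {p\<in>P. \<not> int p dvd a n}"
      using assms(2) by (subst card_Un_disjoint[symmetric]) (auto intro: arg_cong[where f = card])
    ultimately show ?thesis using few[OF n] by (simp add: a_def)
  qed
  have "(real (card P) / 2)\<^sup>2 * real (dyadic_count c S N) =
     (\<Sum>s\<in>sqfree_upto S. \<Sum>n | n \<in> dyadic N \<and> (\<exists>m::int. a n = int s * m\<^sup>2). (real (card P) / 2)\<^sup>2)"
    by (simp add: dyadic_count_def a_def sum_distrib_left sum_distrib_right mult.commute)
  also have "\<dots> \<le> (\<Sum>s\<in>sqfree_upto S. \<Sum>n | n \<in> dyadic N \<and> (\<exists>m::int. a n = int s * m\<^sup>2). (V s n)\<^sup>2)"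
  proof (intro sum_mono power_mono)
    fix s n assume "n \<in> {n. n \<in> dyadic N \<and> (\<exists>m::int. a n = int s * m\<^sup>2)}"
    then show "real (card P) / 2 \<le> V s n" using V_ge by blast
  qed auto
  \<comment> \<open>Nonnegativity of squares admits all \<open>n\<close> of the block; only now are
    the ranges of \<open>s\<close> and \<open>n\<close> independent.\<close>
  also have "\<dots> \<le> (\<Sum>s\<in>sqfree_upto S. \<Sum>n\<in>dyadic N. (V s n)\<^sup>2)"
    by (intro sum_mono sum_mono2) (auto simp: finite_dyadic)
  also have "\<dots> = (\<Sum>s\<in>sqfree_upto S. \<Sum>n\<in>dyadic N. \<Sum>p\<in>P. \<Sum>q\<in>P.
      real_of_int (Legendre (int s) (int p) * Legendre (int s) (int q)) *
      real_of_int (Legendre (a n) (int p) * Legendre (a n) (int q)))"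
    unfolding V_def power2_eq_square sum_product
    using assms(3) by (intro sum.cong refl) (simp add: Legendre_mult ac_simps)
  also have "\<dots> = (\<Sum>s\<in>sqfree_upto S. \<Sum>p\<in>P. \<Sum>q\<in>P. \<Sum>n\<in>dyadic N.
      real_of_int (Legendre (int s) (int p) * Legendre (int s) (int q)) *
      real_of_int (Legendre (a n) (int p) * Legendre (a n) (int q)))"
    apply (rule sum.cong[OF refl])
    apply (rule trans[OF sum.swap])
    apply (rule sum.cong[OF refl])
    apply (rule sum.swap)
    done
  also have "\<dots> = (\<Sum>p\<in>P. \<Sum>q\<in>P. \<Sum>s\<in>sqfree_upto S. \<Sum>n\<in>dyadic N.
      real_of_int (Legendre (int s) (int p) * Legendre (int s) (int q)) *
      real_of_int (Legendre (a n) (int p) * Legendre (a n) (int q)))"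
    apply (rule trans[OF sum.swap])
    apply (rule sum.cong[OF refl])
    apply (rule sum.swap)
    done
  finally show ?thesis by (simp only: sum_product a_def)
qed

text \<open>A squarefree number with odd prime divisors \<open>R\<close> is \<open>\<Prod>R\<close>
  or twice it. This supplies \<open>few\<close> in \<open>large_sieve_quad_char\<close>.\<close>

lemma card_same_odd_part_le:
  "card {t\<in>sqfree_upto S. R = prime_factors t - {2}} \<le> 2"
proof -
  have "{t\<in>sqfree_upto S. R = prime_factors t - {2}} \<subseteq> {\<Prod>R, 2 * \<Prod>R}"
  proof
    fix t assume "t \<in> {t\<in>sqfree_upto S. R = prime_factors t - {2}}"
    then have t: "\<Prod>(prime_factors t) = t" and R: "R = prime_factors t - {2}"
      by (auto simp: sqfree_upto_def squarefree_prod_prime_factors)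
    show "t \<in> {\<Prod>R, 2 * \<Prod>R}"
    proof (cases "2 \<in> prime_factors t")
      case True
      then have "\<Prod>(prime_factors t) = 2 * \<Prod>R" unfolding R by (simp add: prod.remove)
      then show ?thesis using t by simp
    next
      case False
      then have "R = prime_factors t" unfolding R by blast
      then show ?thesis using t by simp
    qed
  qed
  from card_mono[OF _ this] show ?thesis by (simp add: card_insert_if split: if_splits)
qed

section \<open>Mean squares over squarefree numbers and pairs of primes\<close>

text \<open>Here \<open>M = Z\<^sup>2\<close>: two moduli have product at most
  \<open>S * S \<le> M\<close>, and \<open>C\<close> absorbs the powers of 2 in \<open>B\<close>.
  The 6 is \<open>2 * 3\<close> from \<open>2 * Z\<^sup>2 + 1 \<le> 3 * Z\<^sup>2\<close>; the
  \<open>2 * C\<close> comes from \<open>sqrt 2 \<le> 2\<close>.\<close>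

lemma large_sieve_sqfree:
  assumes C: "C \<ge> 1" "\<And>n. n > 0 \<Longrightarrow> 2 ^ card (prime_factors n) \<le> C * real n powr \<delta>"
    and "\<delta> > 0" "1 \<le> S" "S \<le> real Z"
  shows "(\<Sum>m\<le>Z\<^sup>2. (\<Sum>s\<in>sqfree_upto S. real_of_int (quad_char (prime_factors s - {2}) (int m)))\<^sup>2)
    \<le> (6 + 2 * C) * S powr (1 + \<delta>) * (real Z)\<^sup>2"
proof -
  define R where "R s = prime_factors s - {2}" for s :: nat
  have odd: "odd_primes (R s)" for s
  proof -
    have "2 < p" if "prime p" "p \<noteq> 2" for p :: nat using prime_ge_2_nat[OF that(1)] that(2) by linarith
    then show ?thesis by (auto simp: odd_primes_def R_def in_prime_factors_iff)
  qed
  have prod_le: "\<Prod>(R s) \<le> s" if "s \<in> sqfree_upto S" for s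
  proof -
    have "\<Prod>(R s) dvd \<Prod>(prime_factors s)"
      unfolding R_def by (intro prod_dvd_prod_subset) auto
    then have "\<Prod>(R s) dvd s" using that by (simp add: sqfree_upto_def squarefree_prod_prime_factors)
    then show ?thesis using that by (auto simp: sqfree_upto_def dest: dvd_imp_le)
  qed
  have Z: "Z > 0" using assms(4,5) by (auto intro!: Nat.gr0I)
  have "(\<Sum>m\<le>Z\<^sup>2. (\<Sum>s\<in>sqfree_upto S. real_of_int (quad_char (R s) (int m)))\<^sup>2)
    \<le> 2 * real (card (sqfree_upto S)) * real (2 * Z\<^sup>2 + 1) + sqrt 2 * (C * S powr (1 + \<delta>)) * (real (card (sqfree_upto S)))\<^sup>2"
  proof (rule large_sieve_quad_char)
    fix s t assume s: "s \<in> sqfree_upto S" and t: "t \<in> sqfree_upto S"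
    have "\<Prod>(R s \<union> R t) dvd \<Prod>(R s) * \<Prod>(R t)"
      using odd[of s] odd[of t] prod.union_inter[of "R s" "R t" "\<lambda>x. x"]
      unfolding odd_primes_def by (metis dvd_triv_left)
    then have "\<Prod>(R s \<union> R t) \<le> \<Prod>(R s) * \<Prod>(R t)"
      using odd_primes_pos[OF odd[of s]] odd_primes_pos[OF odd[of t]] by (intro dvd_imp_le) auto
    also have "\<dots> \<le> s * t" using s t by (intro mult_mono prod_le) auto
    also have "\<dots> \<le> Z * Z"
      using s t assms(5) by (intro mult_mono) (auto simp: sqfree_upto_def)
    finally show "\<Prod>(R s \<union> R t) \<le> Z\<^sup>2" by (simp add: power2_eq_square)
  next
    fix s assume s: "s \<in> sqfree_upto S"
    then have s0: "s > 0" "real s \<le> S" by (auto simp: sqfree_upto_def)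
    have "(\<Prod>r\<in>R s. 2 * real r) = 2 ^ card (R s) * real (\<Prod>(R s))" by (simp add: prod.distrib)
    also have "\<dots> \<le> 2 ^ card (prime_factors s) * real s"
      using prod_le[OF s] by (intro mult_mono power_increasing card_mono)
        (auto simp: R_def simp del: of_nat_prod)
    also have "\<dots> \<le> (C * real s powr \<delta>) * real s"
      using C(2)[OF s0(1)] by (intro mult_right_mono) auto
    also have "\<dots> \<le> (C * S powr \<delta>) * S"
      using s0 C(1) assms(3) by (intro mult_mono powr_mono2) auto
    also have "\<dots> = C * S powr (1 + \<delta>)" using assms(4) by (simp add: powr_add)
    finally show "(\<Prod>r\<in>R s. 2 * real r) \<le> C * S powr (1 + \<delta>)" .
    show "card {t \<in> sqfree_upto S. R s = R t} \<le> 2" unfolding R_def by (rule card_same_odd_part_le)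
  qed (use odd Z finite_sqfree_upto in auto)
  also have "\<dots> \<le> 6 * S powr (1 + \<delta>) * (real Z)\<^sup>2 + 2 * (C * S powr (1 + \<delta>)) * (real Z)\<^sup>2"
  proof (intro add_mono)
    have card: "real (card (sqfree_upto S)) \<le> S" using assms(4) by (intro card_sqfree_upto_le) auto
    have SS: "S \<le> S powr (1 + \<delta>)" using assms(3,4) powr_mono[of 1 "1 + \<delta>" S] by simp
    have "1 \<le> (real Z)\<^sup>2" using Z by (simp add: Suc_le_eq)
    then have "2 * real (card (sqfree_upto S)) * real (2 * Z\<^sup>2 + 1) \<le> 2 * S powr (1 + \<delta>) * (3 * (real Z)\<^sup>2)"
      using card SS by (intro mult_mono) auto
    then show "2 * real (card (sqfree_upto S)) * real (2 * Z\<^sup>2 + 1) \<le> 6 * S powr (1 + \<delta>) * (real Z)\<^sup>2"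
      by simp
    have "sqrt 2 \<le> 2" by (rule real_le_lsqrt) auto
    then show "sqrt 2 * (C * S powr (1 + \<delta>)) * (real (card (sqfree_upto S)))\<^sup>2 \<le> 2 * (C * S powr (1 + \<delta>)) * (real Z)\<^sup>2"
      using card assms(4,5) C(1) by (intro mult_mono power_mono) auto
  qed
  finally show ?thesis by (simp add: R_def algebra_simps)
qed

text \<open>The conditions under which \<open>quad_char_reciprocity\<close> applies to every pair of
  distinct elements, together with the size bound.\<close>

definition sieve_primes :: "nat \<Rightarrow> nat set \<Rightarrow> bool" where
  "sieve_primes Z P \<longleftrightarrow> (\<forall>p\<in>P. prime p \<and> 2 < p \<and> p \<le> Z) \<and>
     (\<forall>p\<in>P. \<forall>q\<in>P. [p = q] (mod 4) \<and> Legendre 2 (int p) = Legendre 2 (int q))"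

lemma finite_sieve_primes: "sieve_primes Z P \<Longrightarrow> finite P"
  by (rule finite_subset[of _ "{..Z}"]) (auto simp: sieve_primes_def)

lemma inj_on_mult_primes:
  "inj_on (\<lambda>(p, q). p * q) {(p, q). prime p \<and> prime q \<and> p < (q::nat)}"
proof (rule inj_onI, clarsimp)
  fix p q p' q' :: nat
  assume pr: "prime p" "prime q" "prime p'" "prime q'" and lt: "p < q" "p' < q'" and eq: "p * q = p' * q'"
  have "p dvd p' * q'" unfolding eq[symmetric] by simp
  then have "p = p' \<or> p = q'" using pr by (auto simp: prime_dvd_mult_iff primes_dvd_imp_eq)
  then show "p = p' \<and> q = q'" using eq lt pr by (auto dest: prime_gt_0_nat)
qed

text \<open>By unique factorization distinct pairs with \<open>p < q\<close> have distinct products,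
  all at most \<open>Z\<^sup>2\<close>. The factor 2 counts the two orderings.\<close>

lemma sum_prime_pairs_le:
  fixes G :: "nat \<Rightarrow> real"
  assumes "sieve_primes Z P" "\<And>m. G m \<ge> 0"
  shows "(\<Sum>(p, q)\<in>{z\<in>P \<times> P. fst z \<noteq> snd z}. G (p * q)) \<le> 2 * (\<Sum>m\<le>Z\<^sup>2. G m)"
proof -
  define L where "L = {z\<in>P \<times> P. fst z < snd z}"
  have fin: "finite L" using finite_sieve_primes[OF assms(1)] by (simp add: L_def)
  have "{z\<in>P \<times> P. fst z \<noteq> snd z} = L \<union> prod.swap ` L"
    by (force simp: L_def image_iff)
  moreover have "L \<inter> prod.swap ` L = {}" by (auto simp: L_def)
  ultimately have "(\<Sum>(p, q)\<in>{z\<in>P \<times> P. fst z \<noteq> snd z}. G (p * q))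
      = (\<Sum>(p, q)\<in>L. G (p * q)) + (\<Sum>(p, q)\<in>prod.swap ` L. G (p * q))"
    using fin by (simp add: sum.union_disjoint)
  also have "(\<Sum>(p, q)\<in>prod.swap ` L. G (p * q)) = (\<Sum>(p, q)\<in>L. G (p * q))"
    by (subst sum.reindex) (auto simp: case_prod_unfold mult.commute)
  also have "(\<Sum>(p, q)\<in>L. G (p * q)) = (\<Sum>m\<in>(\<lambda>(p, q). p * q) ` L. G m)"
  proof (subst sum.reindex)
    show "inj_on (\<lambda>(p, q). p * q) L"
      using assms(1) by (intro inj_on_subset[OF inj_on_mult_primes]) (auto simp: L_def sieve_primes_def)
  qed (simp add: case_prod_unfold)
  also have "\<dots> \<le> (\<Sum>m\<le>Z\<^sup>2. G m)"
    using assms by (intro sum_mono2) (auto simp: L_def sieve_primes_def power2_eq_square intro!: mult_mono)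
  finally show ?thesis by simp
qed

text \<open>Cauchy-Schwarz over at most \<open>(card P)\<^sup>2\<close> pairs; by reciprocity each
  square depends only on \<open>p * q\<close> and so is a term of the mean square.
  \<open>12 + 4 * C\<close> is twice \<open>6 + 2 * C\<close>, for the two orderings.\<close>

lemma sum_abs_prime_pairs_le:
  assumes C: "C \<ge> 1" "\<And>n. n > 0 \<Longrightarrow> 2 ^ card (prime_factors n) \<le> C * real n powr \<delta>"
    and "\<delta> > 0" "1 \<le> S" "S \<le> real Z" and P: "sieve_primes Z P"
  shows "(\<Sum>(p, q)\<in>{z\<in>P \<times> P. fst z \<noteq> snd z}. \<bar>\<Sum>s\<in>sqfree_upto S. real_of_int (quad_char {p, q} (int s))\<bar>)
    \<le> real (card P) * sqrt (12 + 4 * C) * S powr ((1 + \<delta>) / 2) * real Z"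
proof -
  define X where "X = {z\<in>P \<times> P. fst z \<noteq> snd z}"
  define f where "f z = (case z of (p, q) \<Rightarrow> \<bar>\<Sum>s\<in>sqfree_upto S. real_of_int (quad_char {p, q} (int s))\<bar>)" for z
  define G where "G m = (\<Sum>s\<in>sqfree_upto S. real_of_int (quad_char (prime_factors s - {2}) (int m)))\<^sup>2" for m
  have finP: "finite P" by (rule finite_sieve_primes[OF P])
  have "card X \<le> card (P \<times> P)" unfolding X_def using finP by (intro card_mono) auto
  then have cardX: "real (card X) \<le> (real (card P))\<^sup>2"
    by (simp add: power2_eq_square card_cartesian_product flip: of_nat_mult)
  have f2: "(f z)\<^sup>2 = (case z of (p, q) \<Rightarrow> G (p * q))" if "z \<in> X" for z
  proof -
    obtain p q where z: "z = (p, q)" by (cases z)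
    have "quad_char {p, q} (int s) = quad_char (prime_factors s - {2}) (int (p * q))" if "s \<in> sqfree_upto S" for s
      using that \<open>z \<in> X\<close> P unfolding z
      by (intro quad_char_reciprocity) (auto simp: X_def sieve_primes_def sqfree_upto_def)
    then show ?thesis by (simp add: f_def G_def z)
  qed
  have "(\<Sum>z\<in>X. f z)\<^sup>2 \<le> (\<Sum>z\<in>X. (f z)\<^sup>2) * real (card X)"
    by (rule sum_squared_le_sum_of_squares)
  also have "(\<Sum>z\<in>X. (f z)\<^sup>2) = (\<Sum>(p, q)\<in>X. G (p * q))" by (intro sum.cong refl f2)
  also have "\<dots> \<le> 2 * (\<Sum>m\<le>Z\<^sup>2. G m)"
    unfolding X_def by (rule sum_prime_pairs_le[OF P]) (simp add: G_def)
  also have "(\<Sum>m\<le>Z\<^sup>2. G m) \<le> (6 + 2 * C) * S powr (1 + \<delta>) * (real Z)\<^sup>2"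
    unfolding G_def by (rule large_sieve_sqfree) (use assms in auto)
  finally have "(\<Sum>z\<in>X. f z)\<^sup>2 \<le> 2 * ((6 + 2 * C) * S powr (1 + \<delta>) * (real Z)\<^sup>2) * real (card X)"
    by (simp add: mult_right_mono)
  also have "\<dots> \<le> 2 * ((6 + 2 * C) * S powr (1 + \<delta>) * (real Z)\<^sup>2) * (real (card P))\<^sup>2"
    using C cardX by (intro mult_left_mono) auto
  also have "\<dots> = (real (card P) * sqrt (12 + 4 * C) * S powr ((1 + \<delta>) / 2) * real Z)\<^sup>2"
  proof -
    have "(S powr ((1 + \<delta>) / 2))\<^sup>2 = S powr (1 + \<delta>)"
      using assms(4) by (simp add: power2_eq_square flip: powr_add)
    then show ?thesis using C by (simp add: power_mult_distrib algebra_simps)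
  qed
  finally have "(\<Sum>z\<in>X. f z) \<le> real (card P) * sqrt (12 + 4 * C) * S powr ((1 + \<delta>) / 2) * real Z"
    by (rule power2_le_imp_le) (use C in auto)
  then show ?thesis by (simp add: X_def f_def)
qed

section \<open>The hypothesis for quadratic characters and the range of the exponent\<close>

definition char_sum_bound :: "real \<Rightarrow> real \<Rightarrow> real \<Rightarrow> bool" where
  "char_sum_bound c \<beta> K \<longleftrightarrow> (\<forall>R N. odd_primes R \<longrightarrow> R \<noteq> {} \<longrightarrow> N > 0 \<longrightarrow>
     \<bar>\<Sum>n\<in>dyadic N. real_of_int (quad_char R \<lfloor>real n powr c\<rfloor>)\<bar>
       \<le> K * sqrt (real (\<Prod>R)) * real N powr (1 - \<beta>))"

text \<open>Primitivity of \<open>quad_char\<close> gives the transfer; the maximum with 1 keeps the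
  constant positive even if \<open>K\<close> is not.\<close>

lemma char_sum_boundI:
  assumes "\<forall>(N::nat) (q::nat) (chi::int \<Rightarrow> complex).
      N > 0 \<longrightarrow> q > 1 \<longrightarrow> primitive_character q chi \<longrightarrow>
        norm (\<Sum>n \<in> {n::nat. real N / 2 < real n \<and> n \<le> N}. chi \<lfloor>real n powr c\<rfloor>)
          \<le> K * real q powr (1/2) * real N powr (1 - \<beta>)"
  shows "char_sum_bound c \<beta> (max K 1)"
  unfolding char_sum_bound_def
proof (intro allI impI)
  fix R and N :: nat assume R: "odd_primes R" "R \<noteq> {}" and N: "N > 0"
  obtain r where r: "r \<in> R" using R(2) by blast
  then have "r dvd \<Prod>R" using R(1) dvd_prodI[of R r "\<lambda>x. x"] by (simp add: odd_primes_def)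
  then have "r \<le> \<Prod>R" using odd_primes_pos[OF R(1)] by (rule dvd_imp_le)
  then have q: "\<Prod>R > 1" using r R(1) by (auto simp: odd_primes_def)
  have "\<bar>\<Sum>n\<in>dyadic N. real_of_int (quad_char R \<lfloor>real n powr c\<rfloor>)\<bar>
     = norm (\<Sum>n\<in>dyadic N. complex_of_int (quad_char R \<lfloor>real n powr c\<rfloor>))"
    using norm_of_real[of "\<Sum>n\<in>dyadic N. real_of_int (quad_char R \<lfloor>real n powr c\<rfloor>)", where 'a = complex]
    by simp
  also have "\<dots> \<le> K * real (\<Prod>R) powr (1/2) * real N powr (1 - \<beta>)"
    using assms N q quad_char_primitive[OF R(1)] unfolding dyadic_def by blast
  also have "\<dots> \<le> max K 1 * sqrt (real (\<Prod>R)) * real N powr (1 - \<beta>)"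
    unfolding powr_half_sqrt[OF of_nat_0_le_iff]
    by (intro mult_right_mono) (auto simp del: of_nat_prod)
  finally show "\<bar>\<Sum>n\<in>dyadic N. real_of_int (quad_char R \<lfloor>real n powr c\<rfloor>)\<bar>
       \<le> max K 1 * sqrt (real (\<Prod>R)) * real N powr (1 - \<beta>)" .
qed

text \<open>Both blocks start at \<open>j + 1\<close>, so they differ only in the last
  element.\<close>

lemma dyadic_odd:
  assumes "j \<ge> 1"
  shows "dyadic (2 * j + 1) = insert (2 * j + 1) (dyadic (2 * j))"
  using assms unfolding dyadic_def by (auto simp: field_simps)

lemma finite_primes_upto: "finite {p::nat. prime p \<and> p \<le> Z}"
  by (rule finite_subset[of _ "{..Z}"]) auto

lemma card_odd_primes_upto: "card {p::nat. prime p \<and> p \<le> Z} \<le> card {p. prime p \<and> 2 < p \<and> p \<le> Z} + 1"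
proof -
  let ?U = "{p::nat. prime p \<and> 2 < p \<and> p \<le> Z}"
  have fin: "finite ?U" by (rule finite_subset[of _ "{..Z}"]) auto
  have "p \<in> insert 2 ?U" if "prime p" "p \<le> Z" for p
    using that prime_ge_2_nat[OF that(1)] by (cases "p = 2") auto
  then have "{p::nat. prime p \<and> p \<le> Z} \<subseteq> insert 2 ?U" by blast
  then have "card {p::nat. prime p \<and> p \<le> Z} \<le> card (insert 2 ?U)"
    using fin by (intro card_mono) auto
  also have "\<dots> = card ?U + 1" using fin by (subst card_insert_disjoint) auto
  finally show ?thesis .
qed

text \<open>If \<open>\<beta> > 1\<close>, the sums over two consecutive dyadic blocks differ by a single term, so every
  odd prime up to a small power of \<open>N\<close> would divide \<open>\<lfloor>N powr c\<rfloor>\<close>: too many prime factors.\<close>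

lemma char_sum_bound_le_1:
  assumes "c > 0" "K \<ge> 1" "char_sum_bound c \<beta> K"
  shows "\<beta> \<le> 1"
proof (rule ccontr)
  assume "\<not> \<beta> \<le> 1"
  define \<gamma> where "\<gamma> = \<beta> - 1"
  have \<gamma>: "\<gamma> > 0" using \<open>\<not> \<beta> \<le> 1\<close> by (simp add: \<gamma>_def)
  \<comment> \<open>For primes up to \<open>j powr \<gamma>\<close> the factor \<open>sqrt p\<close>
    costs at most \<open>j powr (\<gamma> / 2)\<close>, which leaves
    \<open>j powr (\<gamma> / 2)\<close> of the saving \<open>j powr \<gamma>\<close>.\<close>
  define Y where "Y j = nat \<lfloor>real j powr \<gamma>\<rfloor>" for j :: nat
  have "filterlim Y at_top sequentially"
    unfolding Y_def using \<gamma>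
    by (intro filterlim_compose[OF filterlim_nat_sequentially] filterlim_compose[OF filterlim_floor_sequentially]) real_asymp
  then have ev1: "eventually (\<lambda>j. 4 * real (Y j) powr (1 - 1/2) + 1 \<le> real (card {p. prime p \<and> p \<le> Y j})) sequentially"
    using eventually_card_primes_ge[of "1/2"] by (auto simp: filterlim_iff)
  have ev2: "eventually (\<lambda>j. 2 * K * real j powr (-(\<gamma> / 2)) < 1) sequentially"
    using \<gamma> assms(2) by real_asymp
  \<comment> \<open>The source of the contradiction: logarithmically many prime divisors against a
    power of \<open>j\<close> many primes up to \<open>Y j\<close>.\<close>
  have ev3: "eventually (\<lambda>j. c * ln (2 * real j + 1) < 4 * (real j powr \<gamma> - 1) powr (1/2) * ln 2) sequentially"
    using \<gamma> assms(1) by real_asymp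
  from eventually_conj[OF ev1 eventually_conj[OF ev2 eventually_conj[OF ev3 eventually_ge_at_top[of 1]]]]
  obtain j where j: "4 * real (Y j) powr (1/2) + 1 \<le> real (card {p. prime p \<and> p \<le> Y j})"
    "2 * K * real j powr (-(\<gamma> / 2)) < 1"
    "c * ln (2 * real j + 1) < 4 * (real j powr \<gamma> - 1) powr (1/2) * ln 2" "j \<ge> 1"
    by (auto simp: eventually_sequentially)
  define N where "N = 2 * j + 1"
  define P where "P = {p. prime p \<and> 2 < p \<and> p \<le> Y j}"
  have dvd: "int p dvd \<lfloor>real N powr c\<rfloor>" if p: "p \<in> P" for p
  proof -
    have odd: "odd_primes {p}" using p by (simp add: odd_primes_def P_def)
    define X where "X n = real_of_int (quad_char {p} \<lfloor>real n powr c\<rfloor>)" for n :: nat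
    have small: "\<bar>\<Sum>n\<in>dyadic M. X n\<bar> \<le> K * real j powr (-(\<gamma> / 2))" if M: "j \<le> M" for M
    proof -
      have "\<bar>\<Sum>n\<in>dyadic M. X n\<bar> \<le> K * sqrt (real p) * real M powr (- \<gamma>)"
        using assms(3) odd M j(4) unfolding char_sum_bound_def X_def \<gamma>_def by fastforce
      also have "\<dots> \<le> K * real j powr (\<gamma> / 2) * real j powr (- \<gamma>)"
      proof (intro mult_mono mult_left_mono)
        have "real p \<le> real j powr \<gamma>"
          using p unfolding P_def Y_def by (simp add: le_nat_floor le_nat_iff le_floor_iff)
        then have "sqrt (real p) \<le> sqrt (real j powr \<gamma>)" by simp
        also have "sqrt (real j powr \<gamma>) = real j powr (\<gamma> / 2)"
          by (simp add: powr_powr flip: powr_half_sqrt)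
        finally show "sqrt (real p) \<le> real j powr (\<gamma> / 2)" .
        show "real M powr (- \<gamma>) \<le> real j powr (- \<gamma>)"
          using M j(4) \<gamma> by (intro powr_mono2') auto
      qed (use assms(2) in auto)
      also have "\<dots> = K * real j powr (-(\<gamma> / 2))"
        using j(4) by (simp add: mult.assoc field_simps flip: powr_add)
      finally show ?thesis .
    qed
    have "(\<Sum>n\<in>dyadic N. X n) = X N + (\<Sum>n\<in>dyadic (2 * j). X n)"
      unfolding N_def dyadic_odd[OF j(4)]
      by (subst sum.insert) (auto simp: finite_dyadic dyadic_def)
    then have "\<bar>X N\<bar> \<le> 2 * (K * real j powr (-(\<gamma> / 2)))"
      using small[of N] small[of "2 * j"] by (simp add: N_def)
    then have "\<bar>X N\<bar> < 1" using j(2) by simp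
    then have "quad_char {p} \<lfloor>real N powr c\<rfloor> = 0" unfolding X_def by linarith
    then show ?thesis by (simp add: quad_char_def Legendre_eq_0_iff)
  qed
  have "{p\<in>P. int p dvd \<lfloor>real N powr c\<rfloor>} = P" using dvd by blast
  then have "real (card P) * ln 2 \<le> c * ln (real N)"
    using card_prime_divisors_le[OF assms(1), of N N P] by (auto simp: P_def N_def)
  moreover have "4 * (real j powr \<gamma> - 1) powr (1/2) \<le> real (card P)"
  proof -
    have "1 \<le> real j powr \<gamma>" using j(4) \<gamma> by (simp add: ge_one_powr_ge_zero)
    moreover have "real j powr \<gamma> - 1 \<le> real (Y j)" unfolding Y_def by linarith
    ultimately have "(real j powr \<gamma> - 1) powr (1/2) \<le> real (Y j) powr (1/2)" by (intro powr_mono2) auto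
    then show ?thesis using j(1) card_odd_primes_upto[of "Y j"] by (simp add: P_def)
  qed
  then have "4 * (real j powr \<gamma> - 1) powr (1/2) * ln 2 \<le> real (card P) * ln 2"
    by (intro mult_right_mono) auto
  moreover have "real N = 2 * real j + 1" by (simp add: N_def)
  ultimately show False using j(3) by simp
qed

text \<open>By the pigeonhole principle, fixing \<open>p mod 4\<close> and the Legendre symbol of 2 costs a factor of at most 4;
  it removes all signs from the reciprocity law for products of two of the remaining primes.\<close>

lemma ex_sieve_primes:
  assumes "4 * x + 1 \<le> real (card {p. prime p \<and> p \<le> Z})"
  shows "\<exists>P. sieve_primes Z P \<and> x \<le> real (card P)"
proof -
  define U where "U = {p::nat. prime p \<and> 2 < p \<and> p \<le> Z}"
  \<comment> \<open>Two Boolean tests suffice: an odd prime is 1 or 3 modulo 4, and the symbol of 2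
    at it is 1 or -1. The summand 1 in the assumption pays for the prime 2.\<close>
  define f where "f p = (p mod 4 = 1, Legendre 2 (int p) = 1)" for p :: nat
  define V where "V y = {p\<in>U. f p = y}" for y
  have finU: "finite U" unfolding U_def using finite_subset[OF _ finite_primes_upto[of Z]] by auto
  have sieve: "sieve_primes Z (V y)" for y
  proof -
    have "[p = q] (mod 4) \<and> Legendre 2 (int p) = Legendre 2 (int q)" if "p \<in> V y" "q \<in> V y" for p q
    proof
      have pq: "f p = f q" "odd p" "odd q" "2 < p" "2 < q"
        using that by (auto simp: V_def U_def prime_odd_nat)
      then have "p mod 4 = q mod 4" unfolding f_def prod.inject by presburger
      then show "[p = q] (mod 4)" by (simp add: cong_def)
      have "Legendre 2 (int p) \<noteq> 0" "Legendre 2 (int q) \<noteq> 0"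
        using pq zdvd_not_zless[of 2 "int p"] zdvd_not_zless[of 2 "int q"] by (auto simp: Legendre_eq_0_iff)
      then show "Legendre 2 (int p) = Legendre 2 (int q)"
        using pq(1) Legendre_cases[of 2 "int p"] Legendre_cases[of 2 "int q"] by (auto simp: f_def)
    qed
    moreover have "prime p \<and> 2 < p \<and> p \<le> Z" if "p \<in> V y" for p
      using that by (simp add: V_def U_def)
    ultimately show ?thesis unfolding sieve_primes_def by blast
  qed
  have "\<exists>y. x \<le> real (card (V y))"
  proof (rule ccontr)
    assume "\<nexists>y. x \<le> real (card (V y))"
    then have lt: "real (card (V y)) < x" for y by (meson not_le)
    have "U = (\<Union>y\<in>UNIV. V y)" by (auto simp: V_def)
    then have "card U \<le> (\<Sum>y\<in>UNIV. card (V y))" by (metis card_UN_le finite)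
    then have "real (card U) \<le> (\<Sum>y\<in>UNIV. real (card (V y)))"
      by (metis of_nat_le_iff of_nat_sum)
    also have "\<dots> < (\<Sum>y\<in>(UNIV :: (bool \<times> bool) set). x)"
      by (intro sum_strict_mono lt) auto
    also have "\<dots> = 4 * x" by (simp flip: UNIV_Times_UNIV)
    finally show False using assms card_odd_primes_upto[of Z] by (simp add: U_def)
  qed
  then show ?thesis using sieve by blast
qed

section \<open>The estimate for one dyadic block\<close>

text \<open>With \<open>k = card P\<close>, each of the \<open>k\<close> diagonal terms is at most
  \<open>S * N\<close>. Off the diagonal the sum over \<open>n\<close> costs
  \<open>K * Z * N powr (1 - \<beta>)\<close>, as \<open>sqrt (p * q) \<le> Z\<close>; the sums over
  \<open>s\<close> bring \<open>k\<close> and the second factor \<open>Z\<close>. Division by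
  \<open>(k / 2)\<^sup>2\<close> leaves \<open>4 / k\<close>.\<close>

lemma sieve_bound:
  assumes "c > 0" "K \<ge> 1" "char_sum_bound c \<beta> K"
    and C: "C \<ge> 1" "\<And>n. n > 0 \<Longrightarrow> 2 ^ card (prime_factors n) \<le> C * real n powr \<delta>"
    and "\<delta> > 0" "1 \<le> S" "S \<le> real Z" and P: "sieve_primes Z P" "P \<noteq> {}" and "N > 0"
    and few: "\<And>n. n \<in> dyadic N \<Longrightarrow> 2 * card {p\<in>P. int p dvd \<lfloor>real n powr c\<rfloor>} \<le> card P"
  shows "real (dyadic_count c S N) \<le> 4 * (S * real N +
    K * sqrt (12 + 4 * C) * S powr ((1 + \<delta>) / 2) * real N powr (1 - \<beta>) * (real Z)\<^sup>2) / real (card P)"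
proof -
  have finP: "finite P" by (rule finite_sieve_primes[OF P(1)])
  have pr: "prime p" "2 < p" "p \<le> Z" if "p \<in> P" for p
    using P(1) that by (auto simp: sieve_primes_def)
  define k where "k = real (card P)"
  have k: "k > 0" using P(2) finP by (simp add: k_def card_gt_0_iff)
  define E where "E = sqrt (12 + 4 * C) * S powr ((1 + \<delta>) / 2) * real Z"
  define A where "A p q = (\<Sum>s\<in>sqfree_upto S. real_of_int (Legendre (int s) (int p) * Legendre (int s) (int q)))" for p q
  define B where "B p q = (\<Sum>n\<in>dyadic N. real_of_int (Legendre \<lfloor>real n powr c\<rfloor> (int p) * Legendre \<lfloor>real n powr c\<rfloor> (int q)))" for p q
  have le1: "\<bar>real_of_int (Legendre a p * Legendre a p)\<bar> \<le> 1" for a p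
    using Legendre_cases[of a p] by auto
  have diag: "A p p * B p p \<le> S * real N" for p
  proof -
    have "\<bar>A p p\<bar> \<le> (\<Sum>s\<in>sqfree_upto S. 1)" unfolding A_def
      by (rule order_trans[OF sum_abs sum_mono]) (rule le1)
    also have "\<dots> \<le> S" using card_sqfree_upto_le[of S] assms(7) by simp
    finally have A: "\<bar>A p p\<bar> \<le> S" .
    have "\<bar>B p p\<bar> \<le> (\<Sum>s\<in>dyadic N. 1)" unfolding B_def
      by (rule order_trans[OF sum_abs sum_mono]) (rule le1)
    also have "\<dots> \<le> real N" using card_dyadic_le[of N] by simp
    finally have B: "\<bar>B p p\<bar> \<le> real N" .
    have "A p p * B p p \<le> \<bar>A p p\<bar> * \<bar>B p p\<bar>" by (metis abs_ge_self abs_mult)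
    also have "\<dots> \<le> S * real N" using A B assms(7) by (intro mult_mono) auto
    finally show ?thesis .
  qed
  have off: "A p q * B p q \<le> \<bar>\<Sum>s\<in>sqfree_upto S. real_of_int (quad_char {p, q} (int s))\<bar> * (K * real Z * real N powr (1 - \<beta>))"
    if pq: "p \<in> P" "q \<in> P" "p \<noteq> q" for p q
  proof -
    have A: "A p q = (\<Sum>s\<in>sqfree_upto S. real_of_int (quad_char {p, q} (int s)))"
      using pq(3) by (simp add: A_def quad_char_def)
    have "\<bar>B p q\<bar> = \<bar>\<Sum>n\<in>dyadic N. real_of_int (quad_char {p, q} \<lfloor>real n powr c\<rfloor>)\<bar>"
      using pq(3) by (simp add: B_def quad_char_def)
    also have "\<dots> \<le> K * sqrt (real (\<Prod>{p, q})) * real N powr (1 - \<beta>)"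
    proof -
      have "odd_primes {p, q}" using pr pq by (simp add: odd_primes_def)
      then show ?thesis using assms(3,11) unfolding char_sum_bound_def by blast
    qed
    also have "\<dots> \<le> K * real Z * real N powr (1 - \<beta>)"
    proof (intro mult_right_mono mult_left_mono)
      have "real (\<Prod>{p, q}) \<le> real Z * real Z"
        using pq pr by (auto intro!: mult_mono)
      then show "sqrt (real (\<Prod>{p, q})) \<le> real Z" by (intro real_le_lsqrt) (auto simp: power2_eq_square)
    qed (use assms(2) in auto)
    finally have B: "\<bar>B p q\<bar> \<le> K * real Z * real N powr (1 - \<beta>)" .
    have "A p q * B p q \<le> \<bar>A p q\<bar> * \<bar>B p q\<bar>" by (metis abs_ge_self abs_mult)
    also have "\<dots> \<le> \<bar>A p q\<bar> * (K * real Z * real N powr (1 - \<beta>))" using B by (intro mult_left_mono) auto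
    finally show ?thesis by (simp add: A)
  qed
  define X where "X = {z\<in>P \<times> P. fst z \<noteq> snd z}"
  have split: "P \<times> P = (\<lambda>p. (p, p)) ` P \<union> X" "(\<lambda>p. (p, p)) ` P \<inter> X = {}" "finite X"
    using finP by (auto simp: X_def)
  have "(k / 2)\<^sup>2 * real (dyadic_count c S N) \<le> (\<Sum>p\<in>P. \<Sum>q\<in>P. A p q * B p q)"
    unfolding A_def B_def k_def by (rule square_sieve) (use assms(1) finP pr few in auto)
  also have "\<dots> = (\<Sum>(p, q)\<in>P \<times> P. A p q * B p q)" by (simp add: sum.cartesian_product)
  also have "\<dots> = (\<Sum>(p, q)\<in>(\<lambda>p. (p, p)) ` P. A p q * B p q) + (\<Sum>(p, q)\<in>X. A p q * B p q)"
    unfolding split(1) using split finP by (intro sum.union_disjoint) auto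
  also have "(\<Sum>(p, q)\<in>(\<lambda>p. (p, p)) ` P. A p q * B p q) = (\<Sum>p\<in>P. A p p * B p p)"
    by (subst sum.reindex) (auto intro: inj_onI)
  also have "\<dots> \<le> (\<Sum>p\<in>P. S * real N)" by (intro sum_mono diag)
  also have "\<dots> = k * (S * real N)" by (simp add: k_def)
  also have "(\<Sum>(p, q)\<in>X. A p q * B p q) \<le> (\<Sum>(p, q)\<in>X. \<bar>\<Sum>s\<in>sqfree_upto S. real_of_int (quad_char {p, q} (int s))\<bar> * (K * real Z * real N powr (1 - \<beta>)))"
  proof (intro sum_mono, clarify)
    fix p q assume "(p, q) \<in> X"
    then show "A p q * B p q \<le> \<bar>\<Sum>s\<in>sqfree_upto S. real_of_int (quad_char {p, q} (int s))\<bar> * (K * real Z * real N powr (1 - \<beta>))"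
      by (intro off) (auto simp: X_def)
  qed
  also have "\<dots> = (\<Sum>(p, q)\<in>X. \<bar>\<Sum>s\<in>sqfree_upto S. real_of_int (quad_char {p, q} (int s))\<bar>) * (K * real Z * real N powr (1 - \<beta>))"
    by (simp add: sum_distrib_right case_prod_unfold)
  also have "\<dots> \<le> (k * E) * (K * real Z * real N powr (1 - \<beta>))"
    using sum_abs_prime_pairs_le[OF C assms(6-8) P(1)] assms(2)
    unfolding X_def E_def k_def by (intro mult_right_mono) (auto simp: mult.assoc)
  finally have "(k / 2)\<^sup>2 * real (dyadic_count c S N) \<le> k * (S * real N + E * (K * real Z * real N powr (1 - \<beta>)))"
    by (simp add: algebra_simps)
  then have "k * (k * real (dyadic_count c S N)) \<le> k * (4 * (S * real N + E * (K * real Z * real N powr (1 - \<beta>))))"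
    by (simp add: power2_eq_square algebra_simps)
  then have "k * real (dyadic_count c S N) \<le> 4 * (S * real N + E * (K * real Z * real N powr (1 - \<beta>)))"
    using k by simp
  then show ?thesis using k by (simp add: field_simps k_def E_def power2_eq_square)
qed

text \<open>The exponent \<open>2 * \<delta>\<close> collects two losses: one from having only
  \<open>Z powr (1 - \<delta>)\<close> primes, one from the bound on
  \<open>2 ^ card (prime_factors n)\<close>.\<close>

lemma dyadic_count_bound:
  assumes "c > 0" "K \<ge> 1" "char_sum_bound c \<beta> K" "0 < \<beta>" "\<beta> \<le> 1" "0 < \<delta>" "\<delta> < 1"
  shows "\<exists>C\<ge>0. \<forall>N S. N > 0 \<longrightarrow> 1 \<le> S \<longrightarrow>
    real (dyadic_count c S N) \<le> C * (S powr (3/4) * real N powr (1 - \<beta> / 2 + 2 * \<delta>))"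
proof -
  obtain C where C: "C \<ge> 1" "\<And>n. n > 0 \<Longrightarrow> 2 ^ card (prime_factors n) \<le> C * real n powr \<delta>"
    using ex_two_power_card_prime_factors_le[OF assms(6)] by blast
  obtain Z0 where Z0: "\<And>Z. Z \<ge> Z0 \<Longrightarrow> 4 * real Z powr (1 - \<delta>) + 1 \<le> real (card {p. prime p \<and> p \<le> Z})"
    using eventually_card_primes_ge[OF assms(6,7)] by (auto simp: eventually_sequentially)
  have "eventually (\<lambda>N. real Z0 \<le> real N powr (\<beta> / 2)) sequentially"
    using assms(4) by real_asymp
  \<comment> \<open>Secures \<open>few\<close>: twice the number of prime divisors stays below the
    number of sieve primes.\<close>
  moreover have "eventually (\<lambda>N. 2 * (c * ln (real N)) \<le> (real N powr (\<beta> / 2)) powr (1 - \<delta>) * ln 2) sequentially"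
    unfolding powr_powr using assms by real_asymp
  ultimately obtain N0 where N0: "\<And>N. N \<ge> N0 \<Longrightarrow> real Z0 \<le> real N powr (\<beta> / 2)"
      "\<And>N. N \<ge> N0 \<Longrightarrow> 2 * (c * ln (real N)) \<le> (real N powr (\<beta> / 2)) powr (1 - \<delta>) * ln 2"
    by (metis (no_types, lifting) eventually_conj eventually_sequentially)
  define E where "E = K * sqrt (12 + 4 * C)"
  have E: "E \<ge> 0" using assms(2) C(1) by (simp add: E_def)
  \<comment> \<open>\<open>N0\<close> covers small \<open>N\<close> by the trivial bound; 8 and
    \<open>16 * E\<close> come from the diagonal and off-diagonal parts of the sieve.\<close>
  define D where "D = 8 + 16 * E + real N0"
  have "real (dyadic_count c S N) \<le> D * (S powr (3/4) * real N powr (1 - \<beta> / 2 + 2 * \<delta>))"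
    if N: "N > 0" and S: "1 \<le> S" for N S
  proof -
    define x where "x = real N"
    have x: "x \<ge> 1" using N by (simp add: x_def)
    define T where "T = S powr (3/4) * x powr (1 - \<beta> / 2)"
    have T_le: "T * x powr (2 * \<delta>) = S powr (3/4) * x powr (1 - \<beta> / 2 + 2 * \<delta>)"
      by (simp only: T_def powr_add mult.assoc)
    have T1: "T \<ge> 1"
    proof -
      have "1 * 1 \<le> T" unfolding T_def using S x assms(5) by (intro mult_mono ge_one_powr_ge_zero) auto
      then show ?thesis by simp
    qed
    have xd: "1 \<le> x powr (2 * \<delta>)" using x assms(6) by (simp add: ge_one_powr_ge_zero)
    have triv: "real (dyadic_count c S N) \<le> x" using dyadic_count_le[OF assms(1)] by (simp add: x_def)
    have "real (dyadic_count c S N) \<le> D * (T * x powr (2 * \<delta>))"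
    \<comment> \<open>At \<open>S = x powr (2 * \<beta> / 3)\<close> the power
      \<open>S powr (3/4)\<close> reaches \<open>x powr (\<beta> / 2)\<close>; from there on
      \<open>T \<ge> x\<close> and the trivial count suffices.\<close>
    proof (cases "N < N0 \<or> x powr (2 * \<beta> / 3) \<le> S")
      case True
      then show ?thesis
      proof
        assume "N < N0"
        then have "x \<le> D" using E by (simp add: D_def x_def)
        moreover have "1 \<le> T * x powr (2 * \<delta>)"
          using mult_mono[OF T1 xd] T1 by simp
        then have "D * 1 \<le> D * (T * x powr (2 * \<delta>))"
          using E by (intro mult_left_mono) (auto simp: D_def)
        ultimately show ?thesis using triv by linarith
      next
        assume "x powr (2 * \<beta> / 3) \<le> S"
        then have "(x powr (2 * \<beta> / 3)) powr (3/4) \<le> S powr (3/4)" by (intro powr_mono2) auto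
        then have "x powr (\<beta> / 2) * x powr (1 - \<beta> / 2) \<le> T"
          unfolding T_def by (intro mult_right_mono) (auto simp: powr_powr)
        then have "x \<le> T" using x by (simp flip: powr_add)
        moreover have "1 * (T * 1) \<le> D * (T * x powr (2 * \<delta>))"
          using E T1 xd by (intro mult_mono) (auto simp: D_def)
        ultimately show ?thesis using triv by linarith
      qed
    next
      case False
      then have NN: "N \<ge> N0" and SN: "S \<le> x powr (2 * \<beta> / 3)" by auto
      \<comment> \<open>The balance point: \<open>S * x / z\<close> and
        \<open>S powr (1/2) * x powr (1 - \<beta>) * z\<close> both equal \<open>T\<close>. This is
        \<open>t1\<close> and, with a loss of \<open>x powr \<delta>\<close>,
        \<open>t2\<close>.\<close>
      define z where "z = S powr (1/4) * x powr (\<beta> / 2)"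
      define Z where "Z = nat \<lceil>z\<rceil>"
      have z_ge: "x powr (\<beta> / 2) \<le> z"
        unfolding z_def using S mult_right_mono[of 1 "S powr (1/4)" "x powr (\<beta> / 2)"]
        by (simp add: ge_one_powr_ge_zero)
      moreover have "1 \<le> x powr (\<beta> / 2)" using x assms(4) by (simp add: ge_one_powr_ge_zero)
      ultimately have z1: "1 \<le> z" by linarith
      have Zz: "z \<le> real Z" "real Z \<le> 2 * z" using z1 unfolding Z_def by linarith+
      have S34: "S powr (3/4) \<le> x powr (\<beta> / 2)"
        using powr_mono2[of "3/4" S "x powr (2 * \<beta> / 3)"] SN S by (simp add: powr_powr)
      have Sz: "S \<le> z"
      proof -
        have "S = S powr (1/4) * S powr (3/4)" using S by (simp flip: powr_add)
        also have "\<dots> \<le> z" unfolding z_def using S34 by (intro mult_left_mono) auto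
        finally show ?thesis .
      qed
      have Sx: "S \<le> x" using SN powr_mono[of "2 * \<beta> / 3" 1 x] x assms(5) by simp
      \<comment> \<open>Allows \<open>Z powr \<delta>\<close> to be replaced by a multiple of
        \<open>x powr \<delta>\<close> in \<open>inv\<close>.\<close>
      have zx: "z \<le> x"
      proof -
        have "S powr (1/4) \<le> (x powr (2 * \<beta> / 3)) powr (1/4)" using SN S by (intro powr_mono2) auto
        then have "z \<le> x powr (\<beta> / 6) * x powr (\<beta> / 2)"
          unfolding z_def by (intro mult_right_mono) (auto simp: powr_powr)
        also have "\<dots> = x powr (\<beta> / 6 + \<beta> / 2)" by (rule powr_add[symmetric])
        also have "\<dots> \<le> x powr 1" using x assms(5) by (intro powr_mono) auto
        finally show ?thesis using x by simp
      qed
      have "real Z0 \<le> real Z" using N0(1)[OF NN] z_ge Zz(1) by (simp add: x_def)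
      then obtain P where P: "sieve_primes Z P" "real Z powr (1 - \<delta>) \<le> real (card P)"
        using ex_sieve_primes Z0[of Z] by (metis of_nat_le_iff)
      have Z1: "1 \<le> real Z" using z1 Zz by linarith
      then have Zp: "0 < real Z powr (1 - \<delta>)" by simp
      then have "0 < real (card P)" using P(2) by linarith
      then have P0: "P \<noteq> {}" by auto
      have few: "2 * card {p\<in>P. int p dvd \<lfloor>real n powr c\<rfloor>} \<le> card P" if "n \<in> dyadic N" for n
      proof -
        let ?k = "real (card {p\<in>P. int p dvd \<lfloor>real n powr c\<rfloor>})"
        have "1 \<le> n" "n \<le> N" using that dyadic_subset[of N] by auto
        then have "?k * ln 2 \<le> c * ln (real N)"
          using P(1) by (intro card_prime_divisors_le assms(1)) (auto simp: sieve_primes_def)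
        then have "2 * ?k * ln 2 \<le> (real N powr (\<beta> / 2)) powr (1 - \<delta>) * ln 2"
          using N0(2)[OF NN] by linarith
        then have "2 * ?k \<le> (real N powr (\<beta> / 2)) powr (1 - \<delta>)" by simp
        also have "\<dots> \<le> real Z powr (1 - \<delta>)"
          using z_ge Zz(1) assms(7) by (intro powr_mono2) (auto simp: x_def)
        finally have "2 * ?k \<le> real (card P)" using P(2) by linarith
        then show ?thesis by linarith
      qed
      have inv: "1 / real (card P) \<le> 2 * x powr \<delta> / real Z"
      proof -
        have "real Z powr \<delta> \<le> (2 * x) powr \<delta>" using Zz zx assms(6) by (intro powr_mono2) auto
        also have "\<dots> = 2 powr \<delta> * x powr \<delta>" using x by (simp add: powr_mult)
        also have "\<dots> \<le> 2 powr 1 * x powr \<delta>" using assms(7) by (intro mult_right_mono powr_mono) auto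
        finally have d: "real Z powr \<delta> \<le> 2 * x powr \<delta>" by simp
        have "1 / real (card P) \<le> 1 / real Z powr (1 - \<delta>)"
          using P(2) Zp by (intro frac_le) auto
        also have "\<dots> = real Z powr \<delta> / real Z" using Z1 by (simp add: powr_diff)
        also have "\<dots> \<le> 2 * x powr \<delta> / real Z" using d by (intro divide_right_mono) auto
        finally show ?thesis .
      qed
      have t1: "S * x = T * z"
      proof -
        have "T * z = (S powr (3/4) * S powr (1/4)) * (x powr (1 - \<beta> / 2) * x powr (\<beta> / 2))"
          by (simp add: T_def z_def)
        also have "\<dots> = S * x" using S x by (simp flip: powr_add)
        finally show ?thesis by simp
      qed
      have t2: "S powr ((1 + \<delta>) / 2) * x powr (1 - \<beta>) * z \<le> T * x powr \<delta>"
      proof -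
        have "S powr ((1 + \<delta>) / 2) = S powr (1/2) * S powr (\<delta> / 2)"
          by (simp add: add_divide_distrib powr_add)
        also have "S powr (\<delta> / 2) \<le> x powr (\<delta> / 2)" using Sx S assms(6) by (intro powr_mono2) auto
        also have "x powr (\<delta> / 2) \<le> x powr \<delta>" using x assms(6) by (intro powr_mono) auto
        finally have "S powr ((1 + \<delta>) / 2) * x powr (1 - \<beta>) * z \<le> (S powr (1/2) * x powr \<delta>) * x powr (1 - \<beta>) * z"
          using z1 by (intro mult_right_mono) (auto simp: mult_left_mono)
        also have "\<dots> = (S powr (1/2) * S powr (1/4)) * (x powr (1 - \<beta>) * x powr (\<beta> / 2)) * x powr \<delta>"
          by (simp add: z_def)
        also have "\<dots> = T * x powr \<delta>" by (simp add: T_def flip: powr_add)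
        finally show ?thesis .
      qed
      define W where "W = S powr ((1 + \<delta>) / 2) * x powr (1 - \<beta>)"
      have "real (dyadic_count c S N) \<le> 4 * (S * x + E * W * (real Z)\<^sup>2) * (1 / real (card P))"
        using sieve_bound[OF assms(1-3) C assms(6) S _ P(1) P0 N few] Sz Zz(1)
        by (simp add: x_def E_def W_def mult.assoc)
      also have "\<dots> \<le> 4 * (S * x + E * W * (real Z)\<^sup>2) * (2 * x powr \<delta> / real Z)"
        using inv E S x by (intro mult_left_mono) (auto simp: W_def)
      also have "\<dots> = 8 * x powr \<delta> * (S * x / real Z) + 8 * x powr \<delta> * E * (W * real Z)"
        using Z1 by (simp add: field_simps power2_eq_square)
      also have "\<dots> \<le> 8 * x powr \<delta> * T + 8 * x powr \<delta> * E * (2 * (T * x powr \<delta>))"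
      proof (intro add_mono mult_left_mono)
        show "S * x / real Z \<le> T" unfolding t1 using Zz(1) z1 T1 by (simp add: divide_le_eq)
        have "W * real Z \<le> W * (2 * z)" using Zz(2) by (intro mult_left_mono) (auto simp: W_def)
        then show "W * real Z \<le> 2 * (T * x powr \<delta>)" using t2 by (simp add: W_def)
      qed (use E in auto)
      also have "\<dots> \<le> 8 * x powr (2 * \<delta>) * T + 16 * E * (T * x powr (2 * \<delta>))"
      proof (intro add_mono mult_right_mono)
        show "8 * x powr \<delta> \<le> 8 * x powr (2 * \<delta>)" using x assms(6) by (simp add: powr_mono)
        have "x powr \<delta> * x powr \<delta> = x powr (2 * \<delta>)" by (simp flip: powr_add)
        then show "8 * x powr \<delta> * E * (2 * (T * x powr \<delta>)) \<le> 16 * E * (T * x powr (2 * \<delta>))"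
          by (simp add: mult_ac)
      qed (use T1 in auto)
      also have "\<dots> = (8 + 16 * E) * (T * x powr (2 * \<delta>))" by (simp add: algebra_simps)
      also have "\<dots> \<le> D * (T * x powr (2 * \<delta>))"
        using T1 by (intro mult_right_mono) (auto simp: D_def)
      finally show ?thesis .
    qed
    then show ?thesis unfolding T_le by (simp add: x_def)
  qed
  moreover have "D \<ge> 0" using E by (simp add: D_def)
  ultimately show ?thesis by blast
qed

section \<open>Summation over dyadic blocks\<close>

text \<open>Halving \<open>N\<close> multiplies the bound by at most
  \<open>r = 2 powr (- e)\<close>, so the blocks form a geometric series; \<open>C / (1 - r)\<close>
  is the solution of \<open>x = C + r * x\<close>.\<close>

lemma frak_Q_bound:
  assumes "C \<ge> 0" "e > 0"
    and D: "\<And>N. N > 0 \<Longrightarrow> real (dyadic_count c S N) \<le> C * real N powr e"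
  shows "real (frak_Q c S N) \<le> C / (1 - 2 powr (- e)) * real N powr e"
proof (induction N rule: less_induct)
  case (less N)
  define r where "r = 2 powr (- e)"
  have r: "0 < r" "r < 1" using assms(2) powr_less_mono[of "- e" 0 2] by (auto simp: r_def)
  show ?case
  proof (cases "N = 0")
    case True
    then show ?thesis by (simp add: frak_Q_def Q_count_def)
  next
    case False
    have "real (frak_Q c S N) \<le> real (dyadic_count c S N) + real (frak_Q c S (N div 2))"
      using frak_Q_dyadic[of c S N] by linarith
    also have "\<dots> \<le> C * real N powr e + C / (1 - r) * real (N div 2) powr e"
      using D less.IH[of "N div 2"] False by (intro add_mono) (auto simp: r_def)
    also have "\<dots> \<le> C * real N powr e + C / (1 - r) * (r * real N powr e)"
    proof (intro add_left_mono mult_left_mono)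
      have "real (N div 2) powr e \<le> (real N / 2) powr e"
        using assms(2) by (intro powr_mono2) auto
      also have "(real N / 2) powr e = r * real N powr e"
        by (simp add: powr_divide powr_minus r_def field_simps)
      finally show "real (N div 2) powr e \<le> r * real N powr e" .
    qed (use assms(1) r in auto)
    also have "C * real N powr e + C / (1 - r) * (r * real N powr e) = C / (1 - r) * real N powr e"
      using r by (simp add: field_simps)
    finally show ?thesis by (simp add: r_def)
  qed
qed

theorem theorem2p5:
  fixes c \<beta> :: real
  assumes "c > 2" and "c \<notin> \<nat>" and "\<beta> > 0"
    and char_bound: "\<exists>K::real. \<forall>(N::nat) (q::nat) (chi::int \<Rightarrow> complex).
      N > 0 \<longrightarrow> q > 1 \<longrightarrow> primitive_character q chi \<longrightarrow>
        norm (\<Sum>n \<in> {n::nat. real N / 2 < real n \<and> n \<le> N}. chi \<lfloor>real n powr c\<rfloor>)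
          \<le> K * real q powr (1/2) * real N powr (1 - \<beta>)"
  shows "\<forall>\<epsilon>>0. \<exists>C::real. \<forall>(N::nat) (S::real).
      N > 0 \<longrightarrow> 1 \<le> S \<longrightarrow> S \<le> real N powr c \<longrightarrow>
        real (frak_Q c S N)
          \<le> C * real N powr \<epsilon> *
              (S * real N powr (1 - \<beta>) + S powr (3/4) * real N powr (1 - \<beta> / 2))"
proof (intro allI impI)
  fix \<epsilon> :: real assume "\<epsilon> > 0"
  have c: "c > 0" using assms(1) by simp
  from char_bound obtain K0 where "char_sum_bound c \<beta> (max K0 1)"
    by (blast intro: char_sum_boundI)
  then obtain K where K: "K \<ge> 1" "char_sum_bound c \<beta> K"
    by (meson max.cobounded2)
  then have \<beta>: "\<beta> \<le> 1" using c char_sum_bound_le_1 by blast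
  \<comment> \<open>Two losses of \<open>N powr \<delta>\<close> have to fit into
    \<open>N powr \<epsilon>\<close>; the cap keeps \<open>\<delta> < 1\<close>.\<close>
  define \<delta> where "\<delta> = min (\<epsilon> / 2) (1 / 2)"
  have \<delta>: "0 < \<delta>" "\<delta> < 1" "2 * \<delta> \<le> \<epsilon>" using \<open>\<epsilon> > 0\<close> by (auto simp: \<delta>_def)
  define e where "e = 1 - \<beta> / 2 + 2 * \<delta>"
  have e: "e > 0" using \<beta> \<delta> by (simp add: e_def)
  obtain C where C: "C \<ge> 0" "\<And>N S. N > 0 \<Longrightarrow> 1 \<le> S \<Longrightarrow>
      real (dyadic_count c S N) \<le> C * (S powr (3/4) * real N powr e)"
    using dyadic_count_bound[OF c K assms(3) \<beta> \<delta>(1,2)] unfolding e_def by blast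
  define C' where "C' = C / (1 - 2 powr (- e))"
  have C': "C' \<ge> 0" using C(1) e powr_less_mono[of "- e" 0 2] by (simp add: C'_def)
  have "real (frak_Q c S N) \<le> C' * real N powr \<epsilon> *
      (S * real N powr (1 - \<beta>) + S powr (3/4) * real N powr (1 - \<beta> / 2))"
    if "N > 0" "1 \<le> S" for N S
  proof -
    have "real (frak_Q c S N) \<le> C * S powr (3/4) / (1 - 2 powr (- e)) * real N powr e"
      using C that e by (intro frak_Q_bound) (auto simp: mult.assoc)
    also have "\<dots> = C' * real N powr (2 * \<delta>) * (S powr (3/4) * real N powr (1 - \<beta> / 2))"
      by (simp add: C'_def e_def powr_add)
    \<comment> \<open>The second summand alone carries the estimate; the first is nonnegative and is
      added.\<close>
    also have "\<dots> \<le> C' * real N powr \<epsilon> * (S * real N powr (1 - \<beta>) + S powr (3/4) * real N powr (1 - \<beta> / 2))"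
      using C' that \<delta> by (intro mult_mono mult_left_mono powr_mono) auto
    finally show ?thesis .
  qed
  then show "\<exists>C::real. \<forall>(N::nat) (S::real).
      N > 0 \<longrightarrow> 1 \<le> S \<longrightarrow> S \<le> real N powr c \<longrightarrow>
        real (frak_Q c S N)
          \<le> C * real N powr \<epsilon> *
              (S * real N powr (1 - \<beta>) + S powr (3/4) * real N powr (1 - \<beta> / 2))"
    by blast
qed

end
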